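(* Let $b>0$, $0<\nu<1$, $\Lambda:=[0,b]$, $D_R:=\{(x,s):0\le x\le s\le b\}$, and $\ell\in\mathbb N$. Assume that $a,\chi\in C^\ell(\Lambda)$, $\mathscr K\in C^\ell(D_R)$, and that $\mathscr K(x,x)\ne 0$ for all $x\in\Lambda$. Let $\varphi_b\in\mathbb R$, let $\varphi$ denote the solution of $$\varphi'(x)=a(x)\varphi(x)+\chi(x)+\int_x^b (s-x)^{\nu-1}\mathscr K(x,s)\varphi(s)\,ds,\quad 0\le x\le b,\qquad \varphi(b)=\varphi_b,$$ and let $\psi:=\varphi'$. Then $$\varphi\in C^1(\Lambda)\cap C^{\ell+1}([0,b)).$$ Moreover, there exists a constant $C$, depending only on the data, such that $$|\varphi^{(\ell+1)}(x)|\le C(b-x)^{\nu-\ell},\qquad 0\le x<b.$$ The solution also admits the terminal expansion $$\varphi(x)=\sum_{(i,k)\in\mathcal I_{\nu,\ell}^{R}}\alpha_{i,k}^{R}(\nu)(b-x)^{k(\nu+1)+i}+Y_{\ell+1}^{R}(x,\nu),\qquad x\in\Lambda,$$ where $\mathcal I_{\nu,\ell}^{R}:=\{(i,k)\in\mathbb N_0^2:\ k(1+\nu)+i<1+\ell\}$, the coefficients $\alpha_{i,k}^{R}(\nu)$ are determined by the data of the problem, and $Y_{\ell+1}^{R}(\cdot,\nu)\in C^{\ell+1}(\Lambda)$. Consequently, $$\psi\in C(\Lambda)\cap C^\ell([0,b)),\qquad |\psi^{(\ell)}(x)|\le C(b-x)^{\nu-\ell},\qquad 0\le x<b.$$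
   Context: $\mathbb N=\{1,2,\dots\}$ and $\mathbb N_0=\mathbb N\cup\{0\}$. The data of the problem are $a,\chi,\mathscr K,\varphi_b,\nu,b$ (and the integer $\ell$). All functions are real-valued. *)

theory Defs
  imports "HOL-Analysis.Analysis"
begin

text \<open>
  \<open>Ck_on n S f\<close> is the class $C^n(S)$, with all derivatives taken relative to \<open>S\<close> (so one-sided
  at boundary points belonging to \<open>S\<close>). It is meant for convex \<open>S\<close> with nonempty interior, where
  these derivatives are unique and the definition agrees with the one by partial derivatives on
  the interior of \<open>S\<close> that extend continuously to \<open>S\<close>; \<open>D i\<close> is the partial derivative in
  direction \<open>i\<close>.
\<close>

primrec Ck_on :: "nat \<Rightarrow> 'a::euclidean_space set \<Rightarrow> ('a \<Rightarrow> real) \<Rightarrow> bool" where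
  "Ck_on 0 S f \<longleftrightarrow> continuous_on S f"
| "Ck_on (Suc n) S f \<longleftrightarrow>
     (\<exists>D. (\<forall>x\<in>S. (f has_derivative (\<lambda>h. \<Sum>i\<in>Basis. (h \<bullet> i) * D i x)) (at x within S)) \<and>
          (\<forall>i\<in>Basis. Ck_on n S (D i)))"

lemma Ck_on_real_Suc:
  fixes S :: "real set"
  shows "Ck_on (Suc n) S f \<longleftrightarrow>
    (\<exists>g. (\<forall>x\<in>S. (f has_real_derivative g x) (at x within S)) \<and> Ck_on n S g)"
proof
  assume "Ck_on (Suc n) S f"
  then obtain D where "\<forall>x\<in>S. (f has_derivative (\<lambda>h. h * D 1 x)) (at x within S)" "Ck_on n S (D 1)"
    by auto
  then show "\<exists>g. (\<forall>x\<in>S. (f has_real_derivative g x) (at x within S)) \<and> Ck_on n S g"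
    by (auto simp: has_field_derivative_def mult.commute[of _ "D 1 _"] intro!: exI[of _ "D 1"])
next
  assume "\<exists>g. (\<forall>x\<in>S. (f has_real_derivative g x) (at x within S)) \<and> Ck_on n S g"
  then obtain g where "\<forall>x\<in>S. (f has_real_derivative g x) (at x within S)" "Ck_on n S g"
    by blast
  then show "Ck_on (Suc n) S f"
    by (auto simp: has_field_derivative_def mult.commute[of _ "g _"] intro!: exI[of _ "\<lambda>_. g"])
qed

lemma Ck_on_real_prod_Suc:
  fixes S :: "(real \<times> real) set"
  shows "Ck_on (Suc n) S f \<longleftrightarrow>
    (\<exists>f1 f2. (\<forall>z\<in>S. (f has_derivative (\<lambda>(h, k). h * f1 z + k * f2 z)) (at z within S)) \<and>
             Ck_on n S f1 \<and> Ck_on n S f2)"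
proof -
  have B: "(Basis :: (real \<times> real) set) = {(1, 0), (0, 1)}"
    by (auto simp: Basis_prod_def)
  have s: "(\<lambda>h::real\<times>real. \<Sum>i\<in>Basis. (h \<bullet> i) * D i x) =
      (\<lambda>(h, k). h * D (1, 0) x + k * D (0, 1) x)" for D :: "real \<times> real \<Rightarrow> real \<times> real \<Rightarrow> real" and x
    unfolding B by (auto simp: fun_eq_iff)
  show ?thesis (is "_ \<longleftrightarrow> ?R")
  proof
    assume "Ck_on (Suc n) S f"
    then obtain D :: "real \<times> real \<Rightarrow> real \<times> real \<Rightarrow> real" where D:
      "\<forall>z\<in>S. (f has_derivative (\<lambda>(h, k). h * D (1, 0) z + k * D (0, 1) z)) (at z within S)"
      "\<forall>i\<in>Basis. Ck_on n S (D i)"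
      unfolding Ck_on.simps s by blast
    have "Ck_on n S (D (1, 0))" "Ck_on n S (D (0, 1))"
      using D(2) by (simp_all add: B)
    with D(1) show ?R
      by (intro exI conjI)
  next
    assume ?R
    then obtain f1 f2 where f:
      "\<forall>z\<in>S. (f has_derivative (\<lambda>(h, k). h * f1 z + k * f2 z)) (at z within S)"
      "Ck_on n S f1" "Ck_on n S f2"
      by blast
    define D :: "real \<times> real \<Rightarrow> real \<times> real \<Rightarrow> real"
      where "D = (\<lambda>i. if i = (1, 0) then f1 else f2)"
    have "D (1, 0) = f1" "D (0, 1) = f2"
      by (simp_all add: D_def)
    with f show "Ck_on (Suc n) S f"
      unfolding Ck_on.simps s by (intro exI[of _ D]) (simp add: B)
  qed
qed

definition nth_deriv_within :: "nat \<Rightarrow> real set \<Rightarrow> (real \<Rightarrow> real) \<Rightarrow> real \<Rightarrow> real" where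
  "nth_deriv_within n S f = ((\<lambda>g x. vector_derivative g (at x within S)) ^^ n) f"

definition D_R :: "real \<Rightarrow> (real \<times> real) set" where
  "D_R b = {(x, s). 0 \<le> x \<and> x \<le> s \<and> s \<le> b}"

text \<open>
  No regularity of \<open>\<phi>\<close> beyond differentiability on $[0,b]$ is required. Differentiability gives
  continuity, so for continuous \<open>K\<close> the integrand is absolutely integrable and the integral is
  never an artefact of totality; the value of \<open>powr\<close> at \<open>s = x\<close> is irrelevant.
\<close>

definition terminal_solution ::
  "real \<Rightarrow> real \<Rightarrow> (real \<Rightarrow> real) \<Rightarrow> (real \<Rightarrow> real) \<Rightarrow> (real \<times> real \<Rightarrow> real) \<Rightarrow> real \<Rightarrow>
   (real \<Rightarrow> real) \<Rightarrow> bool" where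
  "terminal_solution b \<nu> a chi K \<phi>\<^sub>b \<phi> \<longleftrightarrow>
     (\<forall>x\<in>{0..b}. (\<phi> has_real_derivative
        (a x * \<phi> x + chi x + integral {x..b} (\<lambda>s. (s - x) powr (\<nu> - 1) * K (x, s) * \<phi> s)))
        (at x within {0..b})) \<and>
     \<phi> b = \<phi>\<^sub>b"

definition index_set_R :: "real \<Rightarrow> nat \<Rightarrow> (nat \<times> nat) set" where
  "index_set_R \<nu> l = {(i, k). real k * (1 + \<nu>) + real i < 1 + real l}"

text \<open>Real powers with the convention $0^0 = 1$; in the library, \<open>0 powr 0 = 0\<close>.\<close>

definition rpow :: "real \<Rightarrow> real \<Rightarrow> real" where
  "rpow t p = (if p = 0 then 1 else t powr p)"

end

theory Submission
  imports Defs
begin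

text \<open>
  Write \<open>t = b - x\<close> for the distance from the terminal point and \<open>u t = \<phi> (b - t)\<close>. A power substitution
  (\<open>abel_integral_substitution\<close>) brings the equation into the form
  $$u'(t) = A(t)\,u(t) + g(t) + c\,t^\nu \int_0^1 K(b-t,\,b-t\theta(\tau))\,u(t\theta(\tau))\,d\tau,
    \qquad \theta(\tau) = 1-\tau^{1/\nu},$$
  in which the only singular ingredient is the explicit factor $t^\nu$: for a continuous weight
  $\omega$, the function $t \mapsto \int_0^1 \omega(\tau) K(b-t,b-t\theta(\tau)) Y(t\theta(\tau))\,d\tau$ is as
  smooth as $K$ and $Y$ (\<open>Ck_on_weighted_kernel_integral\<close>).
  
  The expansion is found by bootstrapping. Suppose that $u$ is a combination of the monomials
  $t^{k(1+\nu)+i}$ up to a remainder of class $C^m$, where $m \le \ell$. Then the right-hand side is a sum of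
  products $t^q h(t)$ with $q \ge 0$ and $h$ of class $C^m$, where $q$ is $0$, $\nu$, or one of the exponents
  of $u$ or such an exponent plus $\nu$. Taylor's formula for $h$ makes such a product a combination of the
  monomials $t^{q+j}$ up to a function of class $C^m$, because $t^q$ times a Taylor remainder of order $m$ is
  again of class $C^m$ (\<open>Ck_on_rpow_mult_vanishing\<close>). Integration shifts the exponents by one, so they become
  $k(1+\nu)+i$ again, and the remainder becomes of class $C^{m+1}$ (\<open>has_expansion_bootstrap\<close>). Starting
  from the continuity of $u$, this proves the expansion with a remainder of class $C^{\ell+1}$.
  
  Everything else is read off the expansion (\<open>expansion_regularity\<close>). In the derivative of order
  $\ell+1$ the monomials with $k = 0$ disappear, and the exponents with $k \ge 1$ are at least $1+\nu$, whence
  the factor $(b-x)^{\nu-\ell}$. That the coefficients and the constant depend on the data alone is a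
  consequence of the uniqueness of the solution (\<open>terminal_solution_unique\<close>).
\<close>

section \<open>Algebra of the classes of continuously differentiable functions\<close>

lemma Ck_on_imp_continuous_on: "Ck_on n S f \<Longrightarrow> continuous_on S f"
proof (cases n)
  case (Suc k)
  assume "Ck_on n S f"
  then have "\<forall>x\<in>S. f differentiable (at x within S)"
    using Suc by (auto simp: differentiable_def)
  then show ?thesis
    by (simp add: differentiable_imp_continuous_on differentiable_on_def)
qed auto

lemma Ck_on_SucD: "Ck_on (Suc n) S f \<Longrightarrow> Ck_on n S f"
proof (induction n arbitrary: f)
  case 0
  then show ?case using Ck_on_imp_continuous_on Ck_on.simps(1) by blast
next
  case (Suc n)
  then obtain D where "\<forall>x\<in>S. (f has_derivative (\<lambda>h. \<Sum>i\<in>Basis. (h \<bullet> i) * D i x)) (at x within S)"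
    "\<forall>i\<in>Basis. Ck_on (Suc n) S (D i)"
    by (subst (asm) Ck_on.simps(2)) blast
  with Suc.IH show ?case
    by auto
qed

lemma Ck_on_mono: "Ck_on n S f \<Longrightarrow> m \<le> n \<Longrightarrow> Ck_on m S f"
  by (induction n) (auto simp: le_Suc_eq simp del: Ck_on.simps(2) dest: Ck_on_SucD)

lemma Ck_on_cong:
  assumes "Ck_on n S f" "\<And>x. x \<in> S \<Longrightarrow> f x = g x"
  shows "Ck_on n S g"
proof (cases n)
  case 0
  then show ?thesis using assms continuous_on_cong by fastforce
next
  case (Suc k)
  with assms(1) obtain D where D:
    "\<And>x. x \<in> S \<Longrightarrow> (f has_derivative (\<lambda>h. \<Sum>i\<in>Basis. (h \<bullet> i) * D i x)) (at x within S)"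
    "\<forall>i\<in>Basis. Ck_on k S (D i)"
    by auto
  have "(g has_derivative (\<lambda>h. \<Sum>i\<in>Basis. (h \<bullet> i) * D i x)) (at x within S)" if "x \<in> S" for x
    using has_derivative_transform[OF that _ D(1)[OF that]] assms(2) by auto
  with D(2) Suc show ?thesis by auto
qed

lemma Ck_on_real_SucI:
  fixes S :: "real set"
  assumes "\<And>x. x \<in> S \<Longrightarrow> (f has_real_derivative g x) (at x within S)" "Ck_on n S g"
  shows "Ck_on (Suc n) S f"
  using assms by (auto simp: Ck_on_real_Suc simp del: Ck_on.simps)

lemma Ck_on_real_SucE:
  fixes S :: "real set"
  assumes "Ck_on (Suc n) S f"
  obtains g where "\<And>x. x \<in> S \<Longrightarrow> (f has_real_derivative g x) (at x within S)" "Ck_on n S g"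
  using assms by (auto simp: Ck_on_real_Suc simp del: Ck_on.simps)

lemma Ck_on_const [simp]: "Ck_on n S (\<lambda>_. c)"
proof (induction n arbitrary: c)
  case (Suc n)
  then show ?case by (auto intro!: exI[of _ "\<lambda>_ _. 0"])
qed auto

lemma Ck_on_add:
  assumes "Ck_on n S f" "Ck_on n S g"
  shows "Ck_on n S (\<lambda>x. f x + g x)"
  using assms
proof (induction n arbitrary: f g)
  case 0
  then show ?case by (auto intro: continuous_on_add)
next
  case (Suc n)
  obtain D where D: "\<forall>x\<in>S. (f has_derivative (\<lambda>h. \<Sum>i\<in>Basis. (h \<bullet> i) * D i x)) (at x within S)"
    "\<forall>i\<in>Basis. Ck_on n S (D i)"
    using Suc.prems by auto
  obtain E where E: "\<forall>x\<in>S. (g has_derivative (\<lambda>h. \<Sum>i\<in>Basis. (h \<bullet> i) * E i x)) (at x within S)"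
    "\<forall>i\<in>Basis. Ck_on n S (E i)"
    using Suc.prems by auto
  have "((\<lambda>x. f x + g x) has_derivative (\<lambda>h. \<Sum>i\<in>Basis. (h \<bullet> i) * (D i x + E i x))) (at x within S)"
    if "x \<in> S" for x
    using has_derivative_add[OF D(1)[rule_format, OF that] E(1)[rule_format, OF that]]
    by (simp add: sum.distrib distrib_left)
  moreover have "\<forall>i\<in>Basis. Ck_on n S (\<lambda>x. D i x + E i x)"
    using D(2) E(2) Suc.IH by blast
  ultimately show ?case
    by (auto intro!: exI[of _ "\<lambda>i x. D i x + E i x"])
qed

lemma Ck_on_mult:
  assumes "Ck_on n S f" "Ck_on n S g"
  shows "Ck_on n S (\<lambda>x. f x * g x)"
  using assms
proof (induction n arbitrary: f g)
  case 0
  then show ?case by (auto intro: continuous_on_mult)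
next
  case (Suc n)
  obtain D where D: "\<forall>x\<in>S. (f has_derivative (\<lambda>h. \<Sum>i\<in>Basis. (h \<bullet> i) * D i x)) (at x within S)"
    "\<forall>i\<in>Basis. Ck_on n S (D i)"
    using Suc.prems by auto
  obtain E where E: "\<forall>x\<in>S. (g has_derivative (\<lambda>h. \<Sum>i\<in>Basis. (h \<bullet> i) * E i x)) (at x within S)"
    "\<forall>i\<in>Basis. Ck_on n S (E i)"
    using Suc.prems by auto
  have fg: "Ck_on n S f" "Ck_on n S g"
    using Suc.prems Ck_on_SucD by blast+
  have "((\<lambda>x. f x * g x) has_derivative (\<lambda>h. \<Sum>i\<in>Basis. (h \<bullet> i) * (f x * E i x + D i x * g x))) (at x within S)"
    if "x \<in> S" for x
    using has_derivative_mult[OF D(1)[rule_format, OF that] E(1)[rule_format, OF that]]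
    by (simp add: sum.distrib distrib_left sum_distrib_left sum_distrib_right mult_ac)
  moreover have "\<forall>i\<in>Basis. Ck_on n S (\<lambda>x. f x * E i x + D i x * g x)"
    using D(2) E(2) fg by (auto intro!: Ck_on_add Suc.IH)
  ultimately show ?case
    by (auto intro!: exI[of _ "\<lambda>i x. f x * E i x + D i x * g x"])
qed

lemma Ck_on_cmult: "Ck_on n S f \<Longrightarrow> Ck_on n S (\<lambda>x. c * f x)"
  by (rule Ck_on_mult) auto

lemma Ck_on_sum: "(\<And>i. i \<in> I \<Longrightarrow> Ck_on n S (f i)) \<Longrightarrow> Ck_on n S (\<lambda>x. \<Sum>i\<in>I. f i x)"
  by (induction I rule: infinite_finite_induct) (auto intro: Ck_on_add)

lemma Ck_on_reflect:
  assumes "Ck_on n {0..b} f"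
  shows "Ck_on n {0..b} (\<lambda>t::real. f (b - t))"
  using assms
proof (induction n arbitrary: f)
  case 0
  have "continuous_on {0..b} (f \<circ> (\<lambda>t. b - t))"
    using 0 by (intro continuous_on_compose continuous_intros) auto
  then show ?case by (simp add: o_def)
next
  case (Suc n)
  obtain g where g: "\<And>x. x \<in> {0..b} \<Longrightarrow> (f has_real_derivative g x) (at x within {0..b})"
    "Ck_on n {0..b} g"
    using Suc.prems by (rule Ck_on_real_SucE) blast
  have "((\<lambda>t. f (b - t)) has_real_derivative (-1) * g (b - t)) (at t within {0..b})"
    if t: "t \<in> {0..b}" for t
  proof -
    have im: "(\<lambda>t. b - t) ` {0..b} = {0..b}"
      by auto
    have "((\<lambda>t. b - t) has_real_derivative -1) (at t within {0..b})"
      by (auto intro!: derivative_eq_intros)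
    then show ?thesis
      using DERIV_image_chain[of f "g (b - t)" "\<lambda>t. b - t" t "{0..b}" "-1"] g(1) t
      by (auto simp: im o_def)
  qed
  moreover have "Ck_on n {0..b} (\<lambda>t. (-1) * g (b - t))"
    using g(2) Suc.IH Ck_on_cmult by blast
  ultimately show ?case
    by (rule Ck_on_real_SucI)
qed

lemma Ck_on_antiderivative:
  assumes "Ck_on n {0..b} f"
  obtains F where "Ck_on (Suc n) {0..b} F"
    "\<And>t. t \<in> {0..b} \<Longrightarrow> (F has_real_derivative f t) (at t within {0..b::real})"
proof -
  have *: "((\<lambda>t. integral {0..t} f) has_real_derivative f t) (at t within {0..b})"
    if "t \<in> {0..b}" for t
    using integral_has_real_derivative[OF Ck_on_imp_continuous_on[OF assms] that] .
  show thesis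
    by (rule that[OF Ck_on_real_SucI[OF * assms] *])
qed


section \<open>Real powers at the origin\<close>

lemma rpow_mult: "0 \<le> s \<Longrightarrow> 0 \<le> t \<Longrightarrow> rpow (s * t) p = rpow s p * rpow t p"
  by (simp add: rpow_def powr_mult)

lemma rpow_add: "0 \<le> p \<Longrightarrow> 0 \<le> q \<Longrightarrow> rpow t p * rpow t q = rpow t (p + q)"
  by (auto simp: rpow_def powr_add)

lemma rpow_nat: "0 \<le> t \<Longrightarrow> rpow t (real n) = t ^ n"
  by (cases "t = 0") (auto simp: rpow_def powr_realpow)

lemma continuous_on_rpow:
  assumes "0 \<le> p" "continuous_on S f" "\<And>x. x \<in> S \<Longrightarrow> 0 \<le> f x"
  shows "continuous_on S (\<lambda>x. rpow (f x) p)"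
proof (cases "p = 0")
  case False
  with assms show ?thesis
    by (auto simp: rpow_def intro!: continuous_on_powr')
qed (simp add: rpow_def)

text \<open>
  This is where the convention $0^0 = 1$ pays off: it makes the usual formula correct at the origin
  even for \<open>p = 1\<close>, so that no exponent \<open>p \<ge> 1\<close> is exceptional.
\<close>

lemma has_real_derivative_rpow:
  assumes "0 \<le> t" "1 \<le> p" "S \<subseteq> {0..}"
  shows "((\<lambda>t. rpow t p) has_real_derivative p * rpow t (p - 1)) (at t within S)"
proof -
  consider "p = 1" | "p > 1" "t > 0" | "p > 1" "t = 0"
    using assms by linarith
  then show ?thesis
  proof cases
    case 1
    have "((\<lambda>t. t) has_real_derivative 1) (at t within {0..})"
      by (auto intro!: derivative_eq_intros)
    then have "((\<lambda>t. rpow t p) has_real_derivative 1) (at t within {0..})"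
      by (rule has_field_derivative_transform_within[OF _ zero_less_one]) (use assms 1 in \<open>auto simp: rpow_def\<close>)
    with 1 assms(3) show ?thesis
      by (auto simp: rpow_def intro: has_field_derivative_subset)
  next
    case 2
    then show ?thesis
      by (auto simp: rpow_def intro!: derivative_eq_intros)
  next
    case 3
    have "((\<lambda>y. y powr (p - 1)) \<longlongrightarrow> 0) (at 0 within S)"
    proof -
      have "continuous_on {0..} (\<lambda>y::real. y powr (p - 1))"
        using 3 by (intro continuous_on_powr' continuous_intros) auto
      then have "((\<lambda>y::real. y powr (p - 1)) \<longlongrightarrow> 0) (at 0 within {0..})"
        unfolding continuous_on_def using 3 by force
      then show ?thesis
        using assms(3) tendsto_within_subset by blast
    qed
    moreover have "\<forall>\<^sub>F y in at 0 within S. y powr (p - 1) = (rpow y p - rpow 0 p) / (y - 0)"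
      using 3 assms(3) by (auto simp: eventually_at_filter rpow_def powr_diff intro!: always_eventually)
    ultimately have "((\<lambda>y. (rpow y p - rpow 0 p) / (y - 0)) \<longlongrightarrow> 0) (at 0 within S)"
      by (rule Lim_transform_eventually)
    with 3 show ?thesis
      by (simp add: has_field_derivative_iff rpow_def)
  qed
qed

text \<open>
  Monomials whose exponent is large belong to the smooth remainder of an expansion.
\<close>

lemma Ck_on_rpow:
  assumes "real n \<le> p" shows "Ck_on n {0..b} (\<lambda>t. rpow t p)"
  using assms
proof (induction n arbitrary: p)
  case 0
  then show ?case by (auto intro!: continuous_on_rpow continuous_intros)
next
  case (Suc n)
  have "((\<lambda>t. rpow t p) has_real_derivative p * rpow t (p - 1)) (at t within {0..b})"
    if "t \<in> {0..b}" for t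
    using that Suc.prems by (auto intro!: has_real_derivative_rpow)
  moreover have "Ck_on n {0..b} (\<lambda>t. p * rpow t (p - 1))"
    using Suc by (intro Ck_on_cmult) auto
  ultimately show ?case
    by (rule Ck_on_real_SucI)
qed

section \<open>Taylor remainders times real powers\<close>

text \<open>
  These are the functions of class $C^m$ on $[0,b]$ whose derivatives of order less than \<open>m\<close> vanish at
  the origin, that is, the remainders of Taylor polynomials of degree less than \<open>m\<close>. The recursive
  form lets each proof peel off one derivative.
\<close>

primrec vanishing :: "real \<Rightarrow> nat \<Rightarrow> (real \<Rightarrow> real) \<Rightarrow> bool" where
  "vanishing b 0 r \<longleftrightarrow> continuous_on {0..b} r"
| "vanishing b (Suc m) r \<longleftrightarrow> r 0 = 0 \<and>
     (\<exists>r'. (\<forall>t\<in>{0..b}. (r has_real_derivative r' t) (at t within {0..b})) \<and> vanishing b m r')"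

lemma vanishing_SucI:
  assumes "r 0 = 0" "\<And>t. t \<in> {0..b} \<Longrightarrow> (r has_real_derivative r' t) (at t within {0..b})"
    "vanishing b m r'"
  shows "vanishing b (Suc m) r"
  using assms unfolding vanishing.simps by blast

lemma vanishing_imp_Ck_on: "vanishing b m r \<Longrightarrow> Ck_on m {0..b} r"
proof (induction m arbitrary: r)
  case (Suc m)
  then obtain r' where "\<And>t. t \<in> {0..b} \<Longrightarrow> (r has_real_derivative r' t) (at t within {0..b})"
    "Ck_on m {0..b} r'"
    by (metis vanishing.simps(2))
  then show ?case by (rule Ck_on_real_SucI)
qed simp

lemma vanishing_add:
  "vanishing b m r \<Longrightarrow> vanishing b m s \<Longrightarrow> vanishing b m (\<lambda>t. r t + s t)"
proof (induction m arbitrary: r s)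
  case 0
  then show ?case by (auto intro: continuous_on_add)
next
  case (Suc m)
  obtain r' where r': "\<forall>t\<in>{0..b}. (r has_real_derivative r' t) (at t within {0..b})" "vanishing b m r'"
    using Suc.prems by auto
  obtain s' where s': "\<forall>t\<in>{0..b}. (s has_real_derivative s' t) (at t within {0..b})" "vanishing b m s'"
    using Suc.prems by auto
  have "\<forall>t\<in>{0..b}. ((\<lambda>t. r t + s t) has_real_derivative r' t + s' t) (at t within {0..b})"
    using r'(1) s'(1) DERIV_add by blast
  with Suc.IH[OF r'(2) s'(2)] Suc.prems show ?case
    by (auto intro!: exI[of _ "\<lambda>t. r' t + s' t"])
qed

lemma vanishing_cmult:
  "vanishing b m r \<Longrightarrow> vanishing b m (\<lambda>t. c * r t)"
proof (induction m arbitrary: r)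
  case 0
  then show ?case by (auto intro: continuous_intros)
next
  case (Suc m)
  obtain r' where r': "\<forall>t\<in>{0..b}. (r has_real_derivative r' t) (at t within {0..b})" "vanishing b m r'"
    using Suc.prems by auto
  have "\<forall>t\<in>{0..b}. ((\<lambda>t. c * r t) has_real_derivative c * r' t) (at t within {0..b})"
    using r'(1) DERIV_cmult by blast
  with Suc.IH[OF r'(2)] Suc.prems show ?case
    by (auto intro!: exI[of _ "\<lambda>t. c * r' t"])
qed

lemma vanishing_bound:
  assumes "vanishing b m r"
  obtains C where "\<And>t. t \<in> {0..b} \<Longrightarrow> \<bar>r t\<bar> \<le> C * t ^ m"
  using assms
proof (induction m arbitrary: r thesis)
  case 0
  then have "bounded (r ` {0..b})"
    by (auto intro: compact_imp_bounded compact_continuous_image)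
  then obtain C where "\<forall>x\<in>{0..b}. \<bar>r x\<bar> \<le> C"
    by (auto simp: bounded_iff)
  with 0(1)[of C] show ?case by simp
next
  case (Suc m)
  then obtain r' where r': "\<forall>t\<in>{0..b}. (r has_real_derivative r' t) (at t within {0..b})"
    "vanishing b m r'" and r0: "r 0 = 0"
    by auto
  from Suc.IH[OF _ r'(2)] obtain C where C: "\<And>t. t \<in> {0..b} \<Longrightarrow> \<bar>r' t\<bar> \<le> C * t ^ m"
    by blast
  have "\<bar>r t\<bar> \<le> \<bar>C\<bar> * t ^ Suc m" if t: "t \<in> {0..b}" for t
  proof -
    have "norm (r t - r 0) \<le> (\<bar>C\<bar> * t ^ m) * norm (t - 0)"
    proof (rule field_differentiable_bound[of "{0..t}" r r'])
      show "(r has_real_derivative r' z) (at z within {0..t})" if "z \<in> {0..t}" for z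
        using that t r'(1) by (auto intro: has_field_derivative_subset[of _ _ _ "{0..b}"])
      show "norm (r' z) \<le> \<bar>C\<bar> * t ^ m" if z: "z \<in> {0..t}" for z
      proof -
        have "\<bar>r' z\<bar> \<le> C * z ^ m"
          using C[of z] z t by auto
        also have "\<dots> \<le> \<bar>C\<bar> * t ^ m"
          using z by (intro mult_mono power_mono) auto
        finally show ?thesis by simp
      qed
    qed (use t in auto)
    with t r0 show ?thesis by (simp add: mult_ac)
  qed
  with Suc.prems(1) show ?case by blast
qed

text \<open>
  The origin is the only delicate point for the products below; there the bound \<open>\<bar>r t\<bar> \<le> C * t ^ (d + j)\<close>
  leaves \<open>t powr (q + d)\<close>, a positive power.
\<close>

lemma powr_mult_vanishing_tendsto_0:
  assumes "vanishing b (d + j) r" "0 < q + real d"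
  shows "((\<lambda>t. t powr (q - real j) * r t) \<longlongrightarrow> 0) (at 0 within {0..b})"
proof -
  obtain C where C: "\<And>t. t \<in> {0..b} \<Longrightarrow> \<bar>r t\<bar> \<le> C * t ^ (d + j)"
    using vanishing_bound[OF assms(1)] by blast
  have "((\<lambda>t. t powr (q + real d)) \<longlongrightarrow> 0) (at 0 within {0..b})"
  proof -
    have "continuous_on {0..} (\<lambda>t::real. t powr (q + real d))"
      using assms(2) by (intro continuous_on_powr' continuous_intros) auto
    then have "((\<lambda>t. t powr (q + real d)) \<longlongrightarrow> 0) (at 0 within {0..})"
      unfolding continuous_on_def using assms(2) by force
    then show ?thesis
      by (rule tendsto_within_subset) auto
  qed
  then have lim: "((\<lambda>t. C * t powr (q + real d)) \<longlongrightarrow> 0) (at 0 within {0..b})"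
    by (rule tendsto_mult_right_zero)
  have "norm (t powr (q - real j) * r t) \<le> C * t powr (q + real d)" if "t \<in> {0..b}" "t \<noteq> 0" for t
  proof -
    have "norm (t powr (q - real j) * r t) \<le> t powr (q - real j) * (C * t ^ (d + j))"
      using C[OF that(1)] by (simp add: abs_mult mult_left_mono)
    also have "\<dots> = C * (t powr (q - real j) * t powr (real (d + j)))"
      using that by (subst powr_realpow) auto
    also have "\<dots> = C * t powr (q + real d)"
      by (simp flip: powr_add)
    finally show ?thesis .
  qed
  then show ?thesis
    by (intro Lim_null_comparison[OF _ lim]) (auto simp: eventually_at_filter intro!: always_eventually)
qed

text \<open>
  Differentiating \<open>t powr (q - j) * r t\<close> produces \<open>t powr (q - (j + 1)) * r t\<close>, which has lost a power
  of \<open>t\<close>, and \<open>t powr (q - j) * r' t\<close>, in which \<open>r'\<close> vanishes to one order less. In both the budget of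
  zeros minus lost powers drops by one, along with the order of smoothness still to be proved; this is
  why the statement carries the shift \<open>j\<close> through the induction on \<open>d\<close>.
\<close>

lemma vanishing_powr_mult:
  assumes "0 < q" "vanishing b (d + j) r"
  shows "vanishing b d (\<lambda>t. t powr (q - real j) * r t)"
  using assms(2)
proof (induction d arbitrary: j r)
  case 0
  have "((\<lambda>t. t powr (q - real j) * r t) \<longlongrightarrow> t powr (q - real j) * r t) (at t within {0..b})"
    if t: "t \<in> {0..b}" for t
  proof (cases "t = 0")
    case True
    then show ?thesis
      using powr_mult_vanishing_tendsto_0[OF 0, of q] assms(1) by simp
  next
    case False
    have "(r \<longlongrightarrow> r t) (at t within {0..b})"
      using Ck_on_imp_continuous_on[OF vanishing_imp_Ck_on[OF 0]] t by (auto simp: continuous_on_def)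
    with False show ?thesis
      by (auto intro!: tendsto_intros)
  qed
  then show ?case
    by (auto simp: continuous_on_def)
next
  case (Suc d)
  obtain r' where r': "\<forall>t\<in>{0..b}. (r has_real_derivative r' t) (at t within {0..b})"
    "vanishing b (d + j) r'"
    using Suc.prems by auto
  define g where "g t = (q - real j) * (t powr (q - real (Suc j)) * r t) + t powr (q - real j) * r' t" for t
  have "((\<lambda>t. t powr (q - real j) * r t) has_real_derivative g t) (at t within {0..b})"
    if t: "t \<in> {0..b}" for t
  proof (cases "t = 0")
    case True
    have "((\<lambda>y. y powr (q - real (Suc j)) * r y) \<longlongrightarrow> 0) (at 0 within {0..b})"
      using powr_mult_vanishing_tendsto_0[of b d "Suc j" r q] Suc.prems assms(1) by simp
    moreover have "\<forall>\<^sub>F y in at 0 within {0..b}. y powr (q - real (Suc j)) * r y =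
        (y powr (q - real j) * r y - 0 powr (q - real j) * r 0) / (y - 0)"
      by (auto simp: eventually_at_filter powr_diff powr_add intro!: always_eventually)
    ultimately have "((\<lambda>y. (y powr (q - real j) * r y - 0 powr (q - real j) * r 0) / (y - 0)) \<longlongrightarrow> 0)
        (at 0 within {0..b})"
      by (rule Lim_transform_eventually)
    with True show ?thesis
      by (simp add: has_field_derivative_iff g_def)
  next
    case False
    with t r'(1) show ?thesis
      unfolding g_def
      by (auto intro!: derivative_eq_intros simp: algebra_simps)
  qed
  moreover have "vanishing b d g"
    unfolding g_def using Suc.IH[of "Suc j" r] Suc.IH[OF r'(2)] Suc.prems
    by (intro vanishing_add vanishing_cmult) auto
  ultimately show ?case
    by (intro vanishing_SucI) auto
qed

lemma Ck_on_rpow_mult_vanishing: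
  assumes "0 \<le> q" "vanishing b m r"
  shows "Ck_on m {0..b} (\<lambda>t. rpow t q * r t)"
proof (cases "q = 0")
  case True
  then show ?thesis
    using vanishing_imp_Ck_on[OF assms(2)] by (simp add: rpow_def)
next
  case False
  then show ?thesis
    using vanishing_imp_Ck_on[OF vanishing_powr_mult[of q b m 0 r]] assms by (simp add: rpow_def)
qed

text \<open>
  Obtained by integrating the Taylor formula of the derivative, so that no closed form of the remainder
  is called for; only its order of vanishing matters.
\<close>

lemma Taylor_vanishing:
  assumes "Ck_on m {0..b} h"
  obtains c r where "vanishing b m r" "\<And>t. t \<in> {0..b} \<Longrightarrow> h t = (\<Sum>j<m. c j * t ^ j) + r t"
  using assms
proof (induction m arbitrary: h thesis)
  case 0
  then show ?case by simp
next
  case (Suc m)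
  obtain g where g: "\<And>t. t \<in> {0..b} \<Longrightarrow> (h has_real_derivative g t) (at t within {0..b})"
    "Ck_on m {0..b} g"
    using Suc.prems(2) by (rule Ck_on_real_SucE) blast
  from Suc.IH[OF _ g(2)] obtain c r where cr: "vanishing b m r"
    "\<And>t. t \<in> {0..b} \<Longrightarrow> g t = (\<Sum>j<m. c j * t ^ j) + r t"
    by blast
  define R where "R t = h t - (h 0 + (\<Sum>j<m. c j / real (Suc j) * t ^ Suc j))" for t
  have "(R has_real_derivative r t) (at t within {0..b})" if t: "t \<in> {0..b}" for t
  proof -
    have "((\<lambda>t. c j / real (Suc j) * t ^ Suc j) has_real_derivative c j * t ^ j) (at t within {0..b})" for j
      by (rule derivative_eq_intros refl | simp add: field_simps)+
    then have "(R has_real_derivative g t - (0 + (\<Sum>j<m. c j * t ^ j))) (at t within {0..b})"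
      unfolding R_def by (intro DERIV_diff g(1)[OF t] DERIV_add DERIV_const DERIV_sum) 
    with cr(2)[OF t] show ?thesis by simp
  qed
  then have "vanishing b (Suc m) R"
    by (intro vanishing_SucI[OF _ _ cr(1)]) (auto simp: R_def)
  moreover have "h t = (\<Sum>j<Suc m. (case j of 0 \<Rightarrow> h 0 | Suc i \<Rightarrow> c i / real (Suc i)) * t ^ j) + R t" for t
    by (subst sum.lessThan_Suc_shift) (simp add: R_def)
  ultimately show ?case
    using Suc.prems(1)[of R "\<lambda>j. case j of 0 \<Rightarrow> h 0 | Suc i \<Rightarrow> c i / real (Suc i)"] by blast
qed

section \<open>Smoothness of the kernel integral\<close>

lemma D_R_segment:
  assumes "t \<in> {0..b}" "\<sigma> \<in> {0..1}"
  shows "(b - t, b - t * \<sigma>) \<in> D_R b" "t * \<sigma> \<in> {0..b}"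
proof -
  have "0 \<le> t * \<sigma>" "t * \<sigma> \<le> t"
    using assms by (auto simp: mult_left_le)
  with assms show "(b - t, b - t * \<sigma>) \<in> D_R b" "t * \<sigma> \<in> {0..b}"
    by (auto simp: D_R_def)
qed

lemma continuous_on_kernel_product:
  fixes \<theta> \<omega> Y :: "real \<Rightarrow> real" and K :: "real \<times> real \<Rightarrow> real"
  assumes K: "continuous_on (D_R b) K" and Y: "continuous_on {0..b} Y"
    and \<theta>: "continuous_on {0..1::real} \<theta>" "\<theta> ` {0..1} \<subseteq> {0..1}"
    and \<omega>: "continuous_on {0..1} \<omega>"
  shows "continuous_on ({0..b} \<times> {0..1}) (\<lambda>(t, \<tau>). \<omega> \<tau> * K (b - t, b - t * \<theta> \<tau>) * Y (t * \<theta> \<tau>))"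
proof -
  let ?S = "{0..b} \<times> {0..1::real}"
  have comp: "continuous_on ?S (\<lambda>z. f (snd z))" if "continuous_on {0..1} f" for f :: "real \<Rightarrow> real"
    by (rule continuous_on_compose2[OF that continuous_on_snd[OF continuous_on_id]]) auto
  have "(b - fst z, b - fst z * \<theta> (snd z)) \<in> D_R b" "fst z * \<theta> (snd z) \<in> {0..b}" if "z \<in> ?S" for z
    using D_R_segment[of "fst z" b "\<theta> (snd z)"] that \<theta>(2) by auto
  then have "continuous_on ?S (\<lambda>z. K (b - fst z, b - fst z * \<theta> (snd z)))"
    "continuous_on ?S (\<lambda>z. Y (fst z * \<theta> (snd z)))"
    using comp[OF \<theta>(1)]
    by (auto intro!: continuous_on_compose2[OF K] continuous_on_compose2[OF Y] continuous_intros)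
  then show ?thesis
    using comp[OF \<omega>] by (auto simp: case_prod_unfold intro!: continuous_intros)
qed

lemma continuous_on_kernel_slice:
  fixes \<theta> \<omega> Y :: "real \<Rightarrow> real" and K :: "real \<times> real \<Rightarrow> real"
  assumes K: "continuous_on (D_R b) K" and Y: "continuous_on {0..b} Y"
    and \<theta>: "continuous_on {0..1} \<theta>" "\<theta> ` {0..1} \<subseteq> {0..1}"
    and \<omega>: "continuous_on {0..1} \<omega>"
    and t: "t \<in> {0..b}"
  shows "continuous_on {0..1} (\<lambda>\<tau>. \<omega> \<tau> * K (b - t, b - t * \<theta> \<tau>) * Y (t * \<theta> \<tau>))"
proof -
  have "continuous_on {0..1} (\<lambda>\<tau>. (\<lambda>(t, \<tau>). \<omega> \<tau> * K (b - t, b - t * \<theta> \<tau>) * Y (t * \<theta> \<tau>)) (t, \<tau>))"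
    by (rule continuous_on_compose2[OF continuous_on_kernel_product[OF K Y \<theta> \<omega>]])
      (use t in \<open>auto intro!: continuous_intros\<close>)
  then show ?thesis
    by simp
qed

lemmas integrable_kernel_product = integrable_continuous_real[OF continuous_on_kernel_slice]

text \<open>
  Since the weight and the nodes are continuous in \<open>\<tau>\<close> and do not depend on \<open>t\<close>, one may differentiate
  under the integral. The derivative is a sum of three integrals of the same shape: one for each partial
  derivative of \<open>K\<close> and one for \<open>Y'\<close>, with the inner derivatives \<open>-1\<close>, \<open>- \<theta> \<tau>\<close> and \<open>\<theta> \<tau>\<close> absorbed
  in the weight. Keeping the weight arbitrary therefore makes the induction close.
\<close>

lemma Ck_on_weighted_kernel_integral:
  fixes \<theta> \<omega> Y :: "real \<Rightarrow> real" and K :: "real \<times> real \<Rightarrow> real"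
  assumes "Ck_on m (D_R b) K" "Ck_on m {0..b} Y"
    and \<theta>: "continuous_on {0..1::real} \<theta>" "\<theta> ` {0..1} \<subseteq> {0..1}"
    and "continuous_on {0..1} \<omega>"
  shows "Ck_on m {0..b} (\<lambda>t. integral {0..1} (\<lambda>\<tau>. \<omega> \<tau> * K (b - t, b - t * \<theta> \<tau>) * Y (t * \<theta> \<tau>)))"
  using assms(1,2,5)
proof (induction m arbitrary: K Y \<omega>)
  case 0
  then show ?case
    using integral_continuous_on_param[of "{0..b}" 0 1
        "\<lambda>t \<tau>. \<omega> \<tau> * K (b - t, b - t * \<theta> \<tau>) * Y (t * \<theta> \<tau>)"]
      continuous_on_kernel_product[OF _ _ \<theta>, of b K Y \<omega>]
    by simp
next
  case (Suc m)
  obtain K1 K2 where K: "\<And>z. z \<in> D_R b \<Longrightarrow> (K has_derivative (\<lambda>(h, k). h * K1 z + k * K2 z)) (at z within D_R b)"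
    "Ck_on m (D_R b) K1" "Ck_on m (D_R b) K2"
    using Suc.prems(1) unfolding Ck_on_real_prod_Suc by blast
  obtain Y' where Y: "\<And>t. t \<in> {0..b} \<Longrightarrow> (Y has_real_derivative Y' t) (at t within {0..b})"
    "Ck_on m {0..b} Y'"
    using Suc.prems(2) by (rule Ck_on_real_SucE) blast
  have KY: "Ck_on m (D_R b) K" "Ck_on m {0..b} Y"
    using Suc.prems Ck_on_SucD by blast+
  define P where "P \<omega> K Y t \<tau> = \<omega> \<tau> * K (b - t, b - t * \<theta> \<tau>) * Y (t * \<theta> \<tau>)"
    for \<omega> Y :: "real \<Rightarrow> real" and K :: "real \<times> real \<Rightarrow> real" and t \<tau>
  define \<omega>1 \<omega>2 where "\<omega>1 = (\<lambda>\<tau>. - \<omega> \<tau>)" and "\<omega>2 = (\<lambda>\<tau>. - (\<omega> \<tau> * \<theta> \<tau>))"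
  have \<omega>12: "continuous_on {0..1} \<omega>1" "continuous_on {0..1} \<omega>2" "continuous_on {0..1} (\<lambda>\<tau>. \<omega> \<tau> * \<theta> \<tau>)"
    unfolding \<omega>1_def \<omega>2_def using Suc.prems(3) \<theta>(1) by (auto intro!: continuous_intros)
  have c: "continuous_on ({0..b} \<times> {0..1}) (\<lambda>(t, \<tau>). P \<omega> K Y t \<tau>)"
    if "Ck_on m (D_R b) K" "Ck_on m {0..b} Y" "continuous_on {0..1} \<omega>" for K Y \<omega>
    unfolding P_def
    by (rule continuous_on_kernel_product[OF Ck_on_imp_continuous_on[OF that(1)] Ck_on_imp_continuous_on[OF that(2)] \<theta> that(3)])
  have i: "P \<omega> K Y t integrable_on {0..1}"
    if "Ck_on m (D_R b) K" "Ck_on m {0..b} Y" "continuous_on {0..1} \<omega>" "t \<in> {0..b}" for K Y \<omega> t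
    using integrable_kernel_product[OF Ck_on_imp_continuous_on[OF that(1)]
        Ck_on_imp_continuous_on[OF that(2)] \<theta> that(3,4)] by (simp add: P_def[abs_def])
  define g where "g t \<tau> = P \<omega>1 K1 Y t \<tau> + P \<omega>2 K2 Y t \<tau> + P (\<lambda>\<tau>. \<omega> \<tau> * \<theta> \<tau>) K Y' t \<tau>" for t \<tau>
  have "((\<lambda>t. integral {0..1} (P \<omega> K Y t)) has_real_derivative integral {0..1} (g t)) (at t within {0..b})"
    if t: "t \<in> {0..b}" for t
  proof -
    have "((\<lambda>t. integral (cbox 0 1) (P \<omega> K Y t)) has_real_derivative integral (cbox 0 1) (g t)) (at t within {0..b})"
    proof (rule leibniz_rule_field_derivative)
      fix x \<tau> :: real
      assume x: "x \<in> {0..b}" and "\<tau> \<in> cbox 0 1"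
      then have \<theta>\<tau>: "\<theta> \<tau> \<in> {0..1}"
        using \<theta>(2) by (auto simp: image_subset_iff)
      have "((\<lambda>t. K (b - t, b - t * \<theta> \<tau>)) has_derivative
          (\<lambda>h. (\<lambda>(h, k). h * K1 (b - x, b - x * \<theta> \<tau>) + k * K2 (b - x, b - x * \<theta> \<tau>)) (- h, - (h * \<theta> \<tau>))))
          (at x within {0..b})"
        by (rule has_derivative_in_compose2[OF K(1), where s = "{0..b}"])
          (use \<theta>\<tau> x D_R_segment in \<open>auto intro!: derivative_eq_intros\<close>)
      then have 1: "((\<lambda>t. K (b - t, b - t * \<theta> \<tau>)) has_real_derivative
          - (K1 (b - x, b - x * \<theta> \<tau>) + \<theta> \<tau> * K2 (b - x, b - x * \<theta> \<tau>))) (at x within {0..b})"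
        unfolding has_field_derivative_def by (rule has_derivative_eq_rhs) (auto simp: algebra_simps)
      have "((\<lambda>t. Y (t * \<theta> \<tau>)) has_derivative (\<lambda>h. Y' (x * \<theta> \<tau>) * (h * \<theta> \<tau>))) (at x within {0..b})"
        by (rule has_derivative_in_compose2[OF Y(1)[unfolded has_field_derivative_def], where s = "{0..b}"])
          (use \<theta>\<tau> x D_R_segment(2) in \<open>auto intro!: derivative_eq_intros simp del: atLeastAtMost_iff\<close>)
      then have 2: "((\<lambda>t. Y (t * \<theta> \<tau>)) has_real_derivative \<theta> \<tau> * Y' (x * \<theta> \<tau>)) (at x within {0..b})"
        unfolding has_field_derivative_def by (rule has_derivative_eq_rhs) (auto simp: algebra_simps)
      show "((\<lambda>x. P \<omega> K Y x \<tau>) has_real_derivative g x \<tau>) (at x within {0..b})"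
        unfolding P_def g_def
        by (rule derivative_eq_intros 1 2 refl)+ (simp add: P_def \<omega>1_def \<omega>2_def algebra_simps)
    next
      show "P \<omega> K Y x integrable_on cbox 0 1" if "x \<in> {0..b}" for x
        using i[OF KY Suc.prems(3) that] by simp
    next
      show "continuous_on ({0..b} \<times> cbox 0 1) (\<lambda>(x, \<tau>). g x \<tau>)"
        using c[OF K(2) KY(2) \<omega>12(1)] c[OF K(3) KY(2) \<omega>12(2)] c[OF KY(1) Y(2) \<omega>12(3)]
        unfolding g_def by (auto simp: case_prod_unfold intro!: continuous_intros)
    qed (use t in auto)
    then show ?thesis by simp
  qed
  moreover have "Ck_on m {0..b} (\<lambda>t. integral {0..1} (g t))"
  proof (rule Ck_on_cong)
    show "Ck_on m {0..b} (\<lambda>t. integral {0..1} (P \<omega>1 K1 Y t) + integral {0..1} (P \<omega>2 K2 Y t)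
        + integral {0..1} (P (\<lambda>\<tau>. \<omega> \<tau> * \<theta> \<tau>) K Y' t))"
      unfolding P_def
      by (intro Ck_on_add Suc.IH K KY Y \<omega>12)
    fix t assume t: "t \<in> {0..b}"
    note j = i[OF K(2) KY(2) \<omega>12(1) t] i[OF K(3) KY(2) \<omega>12(2) t] i[OF KY(1) Y(2) \<omega>12(3) t]
    show "integral {0..1} (P \<omega>1 K1 Y t) + integral {0..1} (P \<omega>2 K2 Y t)
        + integral {0..1} (P (\<lambda>\<tau>. \<omega> \<tau> * \<theta> \<tau>) K Y' t) = integral {0..1} (g t)"
      unfolding g_def by (simp add: integral_add integrable_add j)
  qed
  ultimately show ?case
    unfolding P_def by (rule Ck_on_real_SucI)
qed

section \<open>Removing the weak singularity of the Volterra integral\<close>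

definition abel_node :: "real \<Rightarrow> real \<Rightarrow> real" where
  "abel_node \<nu> \<tau> = 1 - \<tau> powr (1 / \<nu>)"

lemma abel_node_props:
  assumes "0 < \<nu>"
  shows "continuous_on {0..1} (abel_node \<nu>)" "abel_node \<nu> ` {0..1} \<subseteq> {0..1}"
proof -
  show "continuous_on {0..1} (abel_node \<nu>)"
    unfolding abel_node_def[abs_def] using assms
    by (intro continuous_intros continuous_on_powr') auto
  have "\<tau> powr (1 / \<nu>) \<le> 1" if "0 \<le> \<tau>" "\<tau> \<le> 1" for \<tau>
    using powr_mono2[of "1 / \<nu>" \<tau> 1] that assms by simp
  then show "abel_node \<nu> ` {0..1} \<subseteq> {0..1}"
    by (auto simp: abel_node_def)
qed

text \<open>
  Substituting \<open>s = b - t * abel_node \<nu> \<tau>\<close>, that is, \<open>\<tau> = ((s - (b - t)) / t) powr \<nu>\<close>, turns the singular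
  weight into the constant \<open>t powr \<nu> / \<nu>\<close>. All of the singular behaviour in \<open>t\<close> is now in the factor
  \<open>t powr \<nu>\<close>, and what remains is an integral over a fixed interval with continuous integrand.
\<close>

lemma abel_integral_substitution:
  assumes \<nu>: "0 < \<nu>" and t: "0 \<le> t" and F: "continuous_on {b - t..b} F"
  shows "integral {b - t..b} (\<lambda>s. (s - (b - t)) powr (\<nu> - 1) * F s) =
    t powr \<nu> / \<nu> * integral {0..1} (\<lambda>\<tau>. F (b - t * abel_node \<nu> \<tau>))"
proof (cases "t = 0")
  case False
  with t have t: "t > 0" by simp
  define x where "x = b - t"
  define f where "f \<tau> = F (b - t * abel_node \<nu> \<tau>)" for \<tau>
  define g where "g s = ((s - x) / t) powr \<nu>" for s
  define g' where "g' s = \<nu> / t powr \<nu> * (s - x) powr (\<nu> - 1)" for s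
  have "((\<lambda>s. g' s *\<^sub>R f (g s)) has_integral (integral {g x..g b} f - integral {g b..g x} f)) {x..b}"
  proof (rule has_integral_substitution_general[where s = "{x}" and c = 0 and d = 1])
    show "continuous_on {0..1} f"
      unfolding f_def
    proof (rule continuous_on_compose2[OF F])
      show "continuous_on {0..1} (\<lambda>\<tau>. b - t * abel_node \<nu> \<tau>)"
        using abel_node_props[OF \<nu>] by (intro continuous_intros) auto
      show "(\<lambda>\<tau>. b - t * abel_node \<nu> \<tau>) ` {0..1} \<subseteq> {b - t..b}"
        using abel_node_props(2)[OF \<nu>] t by (auto simp: image_subset_iff mult_left_le)
    qed
    show "continuous_on {x..b} g"
      unfolding g_def using \<nu> t by (intro continuous_on_powr' continuous_intros) auto
    show "g ` {x..b} \<subseteq> {0..1}"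
    proof clarify
      fix s assume "s \<in> {x..b}"
      then show "g s \<in> {0..1}"
        using t \<nu> powr_mono2[of \<nu> "(s - x) / t" 1] by (simp add: g_def x_def)
    qed
    show "(g has_real_derivative g' s) (at s within {x..b})" if "s \<in> {x..b} - {x}" for s
      unfolding g_def g'_def using that t
      by (auto intro!: derivative_eq_intros simp: powr_divide powr_diff)
  qed (use t in \<open>auto simp: x_def\<close>)
  moreover have "g x = 0" "g b = 1"
    using t \<nu> by (auto simp: g_def x_def)
  ultimately have 1: "((\<lambda>s. g' s * f (g s)) has_integral integral {0..1} f) {x..b}"
    by simp
  have "g' s * f (g s) = \<nu> / t powr \<nu> * ((s - x) powr (\<nu> - 1) * F s)" if s: "s \<in> {x..b}" for s
  proof -
    have "abel_node \<nu> (g s) = 1 - (s - x) / t"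
      using s t \<nu> by (simp add: abel_node_def g_def powr_powr x_def)
    with t have "b - t * abel_node \<nu> (g s) = s"
      by (simp add: x_def field_simps)
    then have "f (g s) = F s"
      by (simp add: f_def)
    then show ?thesis by (simp add: g'_def)
  qed
  with 1 have "((\<lambda>s. \<nu> / t powr \<nu> * ((s - x) powr (\<nu> - 1) * F s)) has_integral integral {0..1} f) {x..b}"
    by (metis (no_types, lifting) has_integral_cong)
  from has_integral_mult_right[OF this, of "t powr \<nu> / \<nu>"] t \<nu>
  have "((\<lambda>s. (s - x) powr (\<nu> - 1) * F s) has_integral t powr \<nu> / \<nu> * integral {0..1} f) {x..b}"
    by simp
  then show ?thesis
    unfolding x_def f_def by (rule integral_unique)
qed simp

section \<open>Expansions in the exponents of the terminal singularity\<close>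

definition exponent :: "real \<Rightarrow> nat \<times> nat \<Rightarrow> real" where
  "exponent \<nu> z = real (snd z) * (\<nu> + 1) + real (fst z)"

definition exponents_below :: "real \<Rightarrow> nat \<Rightarrow> (nat \<times> nat) set" where
  "exponents_below \<nu> n = {z. exponent \<nu> z < real n}"

definition has_expansion :: "real \<Rightarrow> real \<Rightarrow> nat \<Rightarrow> (real \<Rightarrow> real) \<Rightarrow> bool" where
  "has_expansion \<nu> b n f \<longleftrightarrow> (\<exists>\<alpha> Y. Ck_on n {0..b} Y \<and>
     (\<forall>t\<in>{0..b}. f t = (\<Sum>z\<in>exponents_below \<nu> n. \<alpha> z * rpow t (exponent \<nu> z)) + Y t))"

text \<open>
  Right-hand sides of the differential equation. Their own exponents, \<open>exponent \<nu> z - 1\<close>, form a less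
  convenient family than those of their antiderivatives, so the class is defined through the latter.
\<close>

definition expandable_antiderivative :: "real \<Rightarrow> real \<Rightarrow> nat \<Rightarrow> (real \<Rightarrow> real) \<Rightarrow> bool" where
  "expandable_antiderivative \<nu> b m f \<longleftrightarrow> (\<exists>U. has_expansion \<nu> b (Suc m) U \<and>
     (\<forall>t\<in>{0..b}. (U has_real_derivative f t) (at t within {0..b})))"

lemma exponent_nonneg: "0 < \<nu> \<Longrightarrow> 0 \<le> exponent \<nu> z"
  by (simp add: exponent_def)

lemma finite_exponents_below:
  assumes "0 < \<nu>" shows "finite (exponents_below \<nu> n)"
proof (rule finite_subset)
  show "exponents_below \<nu> n \<subseteq> {..n} \<times> {..n}"
  proof
    fix z assume "z \<in> exponents_below \<nu> n"
    then have "real (snd z) + (\<nu> * real (snd z) + real (fst z)) < real n"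
      by (simp add: exponents_below_def exponent_def algebra_simps)
    moreover have "0 \<le> \<nu> * real (snd z)"
      using assms by simp
    ultimately have "fst z \<le> n" "snd z \<le> n"
      by linarith+
    then show "z \<in> {..n} \<times> {..n}" by (cases z) auto
  qed
qed simp

lemma has_expansion_Ck_on: "Ck_on n {0..b} f \<Longrightarrow> has_expansion \<nu> b n f"
  unfolding has_expansion_def by (intro exI[of _ "\<lambda>_. 0"] exI[of _ f]) simp

lemma has_expansion_add:
  assumes "has_expansion \<nu> b n f" "has_expansion \<nu> b n g"
  shows "has_expansion \<nu> b n (\<lambda>t. f t + g t)"
proof -
  obtain \<alpha> Y \<beta> Z where
    "Ck_on n {0..b} Y" "\<forall>t\<in>{0..b}. f t = (\<Sum>z\<in>exponents_below \<nu> n. \<alpha> z * rpow t (exponent \<nu> z)) + Y t"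
    "Ck_on n {0..b} Z" "\<forall>t\<in>{0..b}. g t = (\<Sum>z\<in>exponents_below \<nu> n. \<beta> z * rpow t (exponent \<nu> z)) + Z t"
    using assms unfolding has_expansion_def by blast
  then show ?thesis
    unfolding has_expansion_def
    by (intro exI[of _ "\<lambda>z. \<alpha> z + \<beta> z"] exI[of _ "\<lambda>t. Y t + Z t"])
      (auto simp: sum.distrib distrib_right intro: Ck_on_add)
qed

lemma has_expansion_cmult:
  assumes "has_expansion \<nu> b n f"
  shows "has_expansion \<nu> b n (\<lambda>t. c * f t)"
proof -
  obtain \<alpha> Y where
    "Ck_on n {0..b} Y" "\<forall>t\<in>{0..b}. f t = (\<Sum>z\<in>exponents_below \<nu> n. \<alpha> z * rpow t (exponent \<nu> z)) + Y t"
    using assms unfolding has_expansion_def by blast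
  then show ?thesis
    unfolding has_expansion_def
    by (intro exI[of _ "\<lambda>z. c * \<alpha> z"] exI[of _ "\<lambda>t. c * Y t"])
      (auto simp: sum_distrib_left distrib_left mult.assoc intro: Ck_on_cmult)
qed

lemma has_expansion_rpow:
  assumes "0 < \<nu>"
  shows "has_expansion \<nu> b n (\<lambda>t. rpow t (exponent \<nu> z))"
proof (cases "z \<in> exponents_below \<nu> n")
  case True
  have "rpow t (exponent \<nu> z) =
      (\<Sum>y\<in>exponents_below \<nu> n. (if y = z then 1 else 0) * rpow t (exponent \<nu> y)) + 0" for t
    using True finite_exponents_below[OF assms, of n] by (simp add: if_distrib if_distribR cong: if_cong)
  then show ?thesis
    unfolding has_expansion_def
    by (intro exI[of _ "\<lambda>y. if y = z then 1 else 0"] exI[of _ "\<lambda>_. 0"] conjI ballI Ck_on_const)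
next
  case False
  then show ?thesis
    by (intro has_expansion_Ck_on Ck_on_rpow) (simp add: exponents_below_def)
qed

lemma expandable_antiderivative_cong:
  assumes "expandable_antiderivative \<nu> b m f" "\<And>t. t \<in> {0..b} \<Longrightarrow> g t = f t"
  shows "expandable_antiderivative \<nu> b m g"
  using assms unfolding expandable_antiderivative_def by simp

lemma expandable_antiderivative_add:
  assumes "expandable_antiderivative \<nu> b m f" "expandable_antiderivative \<nu> b m g"
  shows "expandable_antiderivative \<nu> b m (\<lambda>t. f t + g t)"
  using assms unfolding expandable_antiderivative_def by (meson DERIV_add has_expansion_add)

lemma expandable_antiderivative_cmult:
  assumes "expandable_antiderivative \<nu> b m f"
  shows "expandable_antiderivative \<nu> b m (\<lambda>t. c * f t)"
  using assms unfolding expandable_antiderivative_def by (meson DERIV_cmult has_expansion_cmult)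

lemma expandable_antiderivative_Ck_on:
  assumes "Ck_on m {0..b} f" shows "expandable_antiderivative \<nu> b m f"
proof -
  obtain F where "Ck_on (Suc m) {0..b} F"
    "\<And>t. t \<in> {0..b} \<Longrightarrow> (F has_real_derivative f t) (at t within {0..b})"
    using Ck_on_antiderivative[OF assms] by blast
  then show ?thesis
    unfolding expandable_antiderivative_def using has_expansion_Ck_on by blast
qed

lemma expandable_antiderivative_sum:
  "(\<And>i. i \<in> I \<Longrightarrow> expandable_antiderivative \<nu> b m (f i)) \<Longrightarrow>
    expandable_antiderivative \<nu> b m (\<lambda>t. \<Sum>i\<in>I. f i t)"
  by (induction I rule: infinite_finite_induct)
    (auto intro: expandable_antiderivative_add expandable_antiderivative_Ck_on)

lemma expandable_antiderivative_rpow: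
  assumes "0 < \<nu>" "0 \<le> q" "q + 1 = exponent \<nu> z"
  shows "expandable_antiderivative \<nu> b m (\<lambda>t. rpow t q)"
  unfolding expandable_antiderivative_def
proof (intro exI conjI ballI)
  show "has_expansion \<nu> b (Suc m) (\<lambda>t. 1 / (q + 1) * rpow t (exponent \<nu> z))"
    by (intro has_expansion_cmult has_expansion_rpow assms)
  show "((\<lambda>t. 1 / (q + 1) * rpow t (exponent \<nu> z)) has_real_derivative rpow t q) (at t within {0..b})"
    if "t \<in> {0..b}" for t
    using DERIV_cmult[OF has_real_derivative_rpow[of t "q + 1" "{0..b}"], of "1 / (q + 1)"] that assms(2)
    by (auto simp flip: assms(3))
qed

text \<open>
  Replacing \<open>h\<close> by its Taylor polynomial costs only an error of class $C^m$, whatever the real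
  exponent \<open>q \<ge> 0\<close>, and each remaining term \<open>t powr (q + j)\<close> integrates to an admissible monomial because
  the exponents are closed under adding naturals.
\<close>

lemma expandable_antiderivative_rpow_mult:
  assumes \<nu>: "0 < \<nu>" and q: "0 \<le> q" "q + 1 = exponent \<nu> z" and h: "Ck_on m {0..b} h"
  shows "expandable_antiderivative \<nu> b m (\<lambda>t. rpow t q * h t)"
proof -
  obtain c r where r: "vanishing b m r"
    and eq: "\<And>t. t \<in> {0..b} \<Longrightarrow> h t = (\<Sum>j<m. c j * t ^ j) + r t"
    using Taylor_vanishing[OF h] by blast
  show ?thesis
  proof (rule expandable_antiderivative_cong)
    have monomial: "expandable_antiderivative \<nu> b m (\<lambda>t. rpow t (q + real j))" for j
      by (rule expandable_antiderivative_rpow[where z = "(fst z + j, snd z)"])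
        (use \<nu> q in \<open>auto simp: exponent_def\<close>)
    show "expandable_antiderivative \<nu> b m (\<lambda>t. (\<Sum>j<m. c j * rpow t (q + real j)) + rpow t q * r t)"
      by (intro monomial expandable_antiderivative_add expandable_antiderivative_sum
          expandable_antiderivative_cmult expandable_antiderivative_Ck_on Ck_on_rpow_mult_vanishing[OF q(1) r])
    show "rpow t q * h t = (\<Sum>j<m. c j * rpow t (q + real j)) + rpow t q * r t" if "t \<in> {0..b}" for t
      using that q(1) unfolding eq[OF that]
      by (simp add: distrib_left sum_distrib_left rpow_nat flip: rpow_add) (simp add: mult_ac)
  qed
qed

lemma has_expansion_of_derivative:
  assumes "expandable_antiderivative \<nu> b m f"
    and "\<And>t. t \<in> {0..b} \<Longrightarrow> (u has_real_derivative f t) (at t within {0..b})"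
  shows "has_expansion \<nu> b (Suc m) u"
proof -
  obtain U where U: "has_expansion \<nu> b (Suc m) U"
    "\<And>t. t \<in> {0..b} \<Longrightarrow> (U has_real_derivative f t) (at t within {0..b})"
    using assms(1) unfolding expandable_antiderivative_def by blast
  have "\<exists>c. \<forall>t\<in>{0..b}. u t - U t = c"
    by (rule has_field_derivative_zero_constant) (auto intro!: derivative_eq_intros assms(2) U(2))
  then obtain c where c: "\<forall>t\<in>{0..b}. u t = U t + c"
    by (auto simp: algebra_simps)
  moreover have "has_expansion \<nu> b (Suc m) (\<lambda>t. U t + c)"
    by (intro has_expansion_add U has_expansion_Ck_on Ck_on_const)
  ultimately show ?thesis
    unfolding has_expansion_def by simp
qed

text \<open>
  One gain of regularity. Insert the expansion of \<open>u\<close> into the equation: a monomial of exponent \<open>p\<close>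
  contributes \<open>t powr p\<close> and \<open>t powr (p + \<nu>)\<close>, each times a function of class $C^m$, because
  \<open>rpow (t * \<theta>) p\<close> factors and \<open>rpow \<theta> p\<close> can be put into the weight of the kernel integral; the
  smooth part of \<open>u\<close> contributes a function of class $C^m$ and \<open>t powr \<nu>\<close> times such a function.
  After integration the exponents are shifted by \<open>1\<close> and \<open>1 + \<nu>\<close>, so they stay in the family
  \<open>k * (\<nu> + 1) + i\<close>, while the order of the remainder has increased by one.
\<close>

lemma has_expansion_bootstrap:
  fixes K :: "real \<times> real \<Rightarrow> real"
  assumes \<nu>: "0 < \<nu>"
    and A: "Ck_on m {0..b} A" and g: "Ck_on m {0..b} g" and K: "Ck_on m (D_R b) K"
    and u: "\<And>t. t \<in> {0..b} \<Longrightarrow> (u has_real_derivative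
      A t * u t + g t + c * (t powr \<nu> * integral {0..1}
        (\<lambda>\<tau>. K (b - t, b - t * abel_node \<nu> \<tau>) * u (t * abel_node \<nu> \<tau>)))) (at t within {0..b})"
    and "has_expansion \<nu> b m u"
  shows "has_expansion \<nu> b (Suc m) u"
proof -
  obtain \<alpha> Y where Y: "Ck_on m {0..b} Y"
    and eq: "\<And>t. t \<in> {0..b} \<Longrightarrow> u t = (\<Sum>z\<in>exponents_below \<nu> m. \<alpha> z * rpow t (exponent \<nu> z)) + Y t"
    using assms(6) unfolding has_expansion_def by blast
  define I where "I = exponents_below \<nu> m"
  have fin: "finite I"
    unfolding I_def using finite_exponents_below[OF \<nu>] .
  note node = abel_node_props[OF \<nu>]
  \<comment> \<open>\<open>Z\<close> is the constant \<open>1\<close> for a monomial, whose power of \<open>\<theta>\<close> sits in the weight, and \<open>Y\<close> for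
    the smooth part, whose weight is \<open>1\<close>.\<close>
  define W where "W \<omega> Z t = integral {0..1}
    (\<lambda>\<tau>. \<omega> \<tau> * K (b - t, b - t * abel_node \<nu> \<tau>) * Z (t * abel_node \<nu> \<tau>))" for \<omega> Z t
  define \<omega> where "\<omega> z \<tau> = rpow (abel_node \<nu> \<tau>) (exponent \<nu> z)" for z \<tau>
  have cont_\<omega>: "continuous_on {0..1} (\<omega> z)" for z
    unfolding \<omega>_def using node exponent_nonneg[OF \<nu>] by (intro continuous_on_rpow) (auto simp: image_subset_iff)
  have W: "Ck_on m {0..b} (W \<omega>' Z)" if "continuous_on {0..1} \<omega>'" "Ck_on m {0..b} Z" for \<omega>' Z
    unfolding W_def by (rule Ck_on_weighted_kernel_integral[OF K that(2) node that(1)])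
  have split: "integral {0..1} (\<lambda>\<tau>. K (b - t, b - t * abel_node \<nu> \<tau>) * u (t * abel_node \<nu> \<tau>)) =
      (\<Sum>z\<in>I. \<alpha> z * (rpow t (exponent \<nu> z) * W (\<omega> z) (\<lambda>_. 1) t)) + W (\<lambda>_. 1) Y t"
    if t: "t \<in> {0..b}" for t
  proof -
    note int = integrable_kernel_product[OF Ck_on_imp_continuous_on[OF K] _ node _ t]
    have "K (b - t, b - t * abel_node \<nu> \<tau>) * u (t * abel_node \<nu> \<tau>) =
      (\<Sum>z\<in>I. (\<alpha> z * rpow t (exponent \<nu> z)) *
         (\<omega> z \<tau> * K (b - t, b - t * abel_node \<nu> \<tau>) * 1))
      + 1 * K (b - t, b - t * abel_node \<nu> \<tau>) * Y (t * abel_node \<nu> \<tau>)" if "\<tau> \<in> {0..1}" for \<tau>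
    proof -
      have n: "abel_node \<nu> \<tau> \<in> {0..1}"
        using node(2) that by (auto simp: image_subset_iff)
      have r: "rpow (t * abel_node \<nu> \<tau>) p = rpow t p * rpow (abel_node \<nu> \<tau>) p" for p
        using n t by (intro rpow_mult) auto
      show ?thesis
        unfolding eq[OF D_R_segment(2)[OF t n]] r \<omega>_def I_def
        by (simp add: sum_distrib_left distrib_left mult_ac)
    qed
    then have "integral {0..1} (\<lambda>\<tau>. K (b - t, b - t * abel_node \<nu> \<tau>) * u (t * abel_node \<nu> \<tau>)) =
      integral {0..1} (\<lambda>\<tau>. (\<Sum>z\<in>I. (\<alpha> z * rpow t (exponent \<nu> z)) *
         (\<omega> z \<tau> * K (b - t, b - t * abel_node \<nu> \<tau>) * 1))
      + 1 * K (b - t, b - t * abel_node \<nu> \<tau>) * Y (t * abel_node \<nu> \<tau>))"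
      by (intro Henstock_Kurzweil_Integration.integral_cong)
    also have "\<dots> = integral {0..1} (\<lambda>\<tau>. \<Sum>z\<in>I. (\<alpha> z * rpow t (exponent \<nu> z)) *
         (\<omega> z \<tau> * K (b - t, b - t * abel_node \<nu> \<tau>) * 1))
      + W (\<lambda>_. 1) Y t"
      unfolding W_def
      by (intro Henstock_Kurzweil_Integration.integral_add integrable_sum integrable_on_mult_right
          int cont_\<omega> continuous_on_const Ck_on_imp_continuous_on[OF Y] fin)
    also have "integral {0..1} (\<lambda>\<tau>. \<Sum>z\<in>I. (\<alpha> z * rpow t (exponent \<nu> z)) *
         (\<omega> z \<tau> * K (b - t, b - t * abel_node \<nu> \<tau>) * 1)) =
      (\<Sum>z\<in>I. integral {0..1} (\<lambda>\<tau>. (\<alpha> z * rpow t (exponent \<nu> z)) *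
         (\<omega> z \<tau> * K (b - t, b - t * abel_node \<nu> \<tau>) * 1)))"
      by (intro integral_sum integrable_on_mult_right int cont_\<omega> continuous_on_const fin)
    also have "\<dots> = (\<Sum>z\<in>I. \<alpha> z * (rpow t (exponent \<nu> z) * W (\<omega> z) (\<lambda>_. 1) t))"
      unfolding W_def by (simp only: integral_mult_right mult.assoc)
    finally show ?thesis .
  qed
  show ?thesis
  proof (rule has_expansion_of_derivative[OF expandable_antiderivative_cong u])
    have 1: "expandable_antiderivative \<nu> b m (\<lambda>t. rpow t (exponent \<nu> z) * A t)" for z
      by (rule expandable_antiderivative_rpow_mult[where z = "(fst z + 1, snd z)"])
        (use \<nu> A in \<open>auto simp: exponent_nonneg\<close>, simp add: exponent_def)
    have 2: "expandable_antiderivative \<nu> b m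
        (\<lambda>t. rpow t (exponent \<nu> z + \<nu>) * W (\<omega> z) (\<lambda>_. 1) t)" for z
      by (rule expandable_antiderivative_rpow_mult[where z = "(fst z, snd z + 1)"])
        (use \<nu> exponent_nonneg[OF \<nu>, of z] in
          \<open>auto simp: exponent_def algebra_simps intro!: W cont_\<omega>\<close>)
    have 3: "expandable_antiderivative \<nu> b m (\<lambda>t. rpow t \<nu> * W (\<lambda>_. 1) Y t)"
      by (rule expandable_antiderivative_rpow_mult[where z = "(0, 1)"])
        (use \<nu> in \<open>auto simp: exponent_def intro!: W Y\<close>)
    show "expandable_antiderivative \<nu> b m (\<lambda>t.
        (\<Sum>z\<in>I. \<alpha> z * (rpow t (exponent \<nu> z) * A t)) + A t * Y t + g t
        + c * (\<Sum>z\<in>I. \<alpha> z * (rpow t (exponent \<nu> z + \<nu>) * W (\<omega> z) (\<lambda>_. 1) t))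
        + c * (rpow t \<nu> * W (\<lambda>_. 1) Y t))"
      by (intro expandable_antiderivative_add expandable_antiderivative_sum expandable_antiderivative_cmult
          1 2 3 expandable_antiderivative_Ck_on[OF g] expandable_antiderivative_Ck_on[OF Ck_on_mult[OF A Y]])
    fix t assume t: "t \<in> {0..b}"
    have r: "rpow t (exponent \<nu> z + \<nu>) = t powr \<nu> * rpow t (exponent \<nu> z)" for z
      using \<nu> rpow_add[of "exponent \<nu> z" \<nu> t] exponent_nonneg[OF \<nu>, of z] by (simp add: rpow_def[of t \<nu>] mult.commute)
    have r': "rpow t \<nu> = t powr \<nu>"
      using \<nu> by (simp add: rpow_def)
    show "A t * u t + g t + c * (t powr \<nu> * integral {0..1}
        (\<lambda>\<tau>. K (b - t, b - t * abel_node \<nu> \<tau>) * u (t * abel_node \<nu> \<tau>))) =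
      (\<Sum>z\<in>I. \<alpha> z * (rpow t (exponent \<nu> z) * A t)) + A t * Y t + g t
        + c * (\<Sum>z\<in>I. \<alpha> z * (rpow t (exponent \<nu> z + \<nu>) * W (\<omega> z) (\<lambda>_. 1) t))
        + c * (rpow t \<nu> * W (\<lambda>_. 1) Y t)"
      unfolding split[OF t] eq[OF t] r r' I_def
      by (simp add: sum_distrib_left sum_distrib_right distrib_left mult_ac)
  qed
qed

section \<open>Iterated derivatives along a chain\<close>

lemma nth_deriv_within_eq:
  assumes chain: "\<And>j x. j < n \<Longrightarrow> x \<in> S \<Longrightarrow> (G j has_real_derivative G (Suc j) x) (at x within S)"
    and S: "\<And>x. x \<in> S \<Longrightarrow> at x within S \<noteq> bot"
    and f: "\<And>x. x \<in> S \<Longrightarrow> f x = G 0 x"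
    and "x \<in> S"
  shows "nth_deriv_within n S f x = G n x"
proof -
  have "\<forall>x\<in>S. nth_deriv_within m S f x = G m x" if "m \<le> n" for m
    using that
  proof (induction m)
    case 0
    then show ?case using f by (simp add: nth_deriv_within_def)
  next
    case (Suc m)
    show ?case
    proof
      fix x assume x: "x \<in> S"
      have "(G m has_real_derivative G (Suc m) x) (at x within S)"
        using chain[of m x] Suc.prems x by simp
      then have "(nth_deriv_within m S f has_real_derivative G (Suc m) x) (at x within S)"
        by (rule has_field_derivative_transform_within[OF _ zero_less_one x]) (use Suc in auto)
      then have "vector_derivative (nth_deriv_within m S f) (at x within S) = G (Suc m) x"
        by (intro vector_derivative_within[OF S[OF x]])
          (simp add: has_real_derivative_iff_has_vector_derivative)
      then show "nth_deriv_within (Suc m) S f x = G (Suc m) x"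
        by (simp add: nth_deriv_within_def)
    qed
  qed
  with \<open>x \<in> S\<close> show ?thesis by blast
qed

lemma Ck_on_obtain_derivatives:
  fixes S :: "real set"
  assumes "Ck_on n S f"
  obtains G where "G 0 = f" "continuous_on S (G n)"
    "\<And>j x. j < n \<Longrightarrow> x \<in> S \<Longrightarrow> (G j has_real_derivative G (Suc j) x) (at x within S)"
  using assms
proof (induction n arbitrary: f thesis)
  case 0
  then show ?case by (auto intro: 0(1)[of "\<lambda>_. f"])
next
  case (Suc n)
  obtain g where g: "\<And>x. x \<in> S \<Longrightarrow> (f has_real_derivative g x) (at x within S)" "Ck_on n S g"
    using Suc.prems(2) by (rule Ck_on_real_SucE) blast
  from Suc.IH[OF _ g(2)] obtain G where G: "G 0 = g" "continuous_on S (G n)"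
    "\<And>j x. j < n \<Longrightarrow> x \<in> S \<Longrightarrow> (G j has_real_derivative G (Suc j) x) (at x within S)"
    by blast
  show ?case
  proof (rule Suc.prems(1)[of "case_nat f G"])
    show "(case_nat f G j has_real_derivative case_nat f G (Suc j) x) (at x within S)"
      if "j < Suc n" "x \<in> S" for j x
      using that G g by (cases j) auto
  qed (use G in auto)
qed

lemma Ck_on_of_derivatives:
  fixes S :: "real set"
  assumes "\<And>j x. j < n \<Longrightarrow> x \<in> S \<Longrightarrow> (G j has_real_derivative G (Suc j) x) (at x within S)"
    and "continuous_on S (G n)"
  shows "Ck_on n S (G 0)"
  using assms
proof (induction n arbitrary: G)
  case (Suc n)
  have "Ck_on n S (G (Suc 0))"
    using Suc.IH[of "\<lambda>j. G (Suc j)"] Suc.prems by simp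
  with Suc.prems show ?case
    by (intro Ck_on_real_SucI[where g = "G (Suc 0)"]) auto
qed simp

section \<open>Regularity read off an expansion\<close>

text \<open>
  The \<open>j\<close>-th derivative of \<open>(b - x) powr p\<close>; the factors \<open>i - p\<close> include the sign from the inner
  derivative \<open>-1\<close>.
\<close>

definition powr_derivative :: "real \<Rightarrow> real \<Rightarrow> nat \<Rightarrow> real \<Rightarrow> real" where
  "powr_derivative b p j x = (\<Prod>i<j. real i - p) * (b - x) powr (p - real j)"

lemma has_real_derivative_powr_derivative:
  assumes "x < b"
  shows "(powr_derivative b p j has_real_derivative powr_derivative b p (Suc j) x) (at x within S)"
proof -
  have "((\<lambda>x. (b - x) powr (p - real j)) has_real_derivative
      (real j - p) * (b - x) powr (p - real (Suc j))) (at x within S)"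
    using assms by (auto intro!: derivative_eq_intros simp: algebra_simps)
  from DERIV_cmult[OF this, of "\<Prod>i<j. real i - p"] show ?thesis
    unfolding powr_derivative_def[abs_def] by (simp add: mult.assoc)
qed

text \<open>
  If \<open>snd z = 0\<close>, the monomial is a polynomial of degree at most \<open>l\<close> and its derivative of order
  \<open>l + 1\<close> is zero. All other exponents are at least \<open>1 + \<nu>\<close>, and \<open>(b - x) powr (1 + \<nu>)\<close> is the
  extreme case.
\<close>

lemma powr_derivative_bound:
  assumes "0 < \<nu>" "0 \<le> x" "x < b" "z \<in> exponents_below \<nu> (Suc l)"
  shows "\<bar>powr_derivative b (exponent \<nu> z) (Suc l) x\<bar> \<le>
    \<bar>\<Prod>i<Suc l. real i - exponent \<nu> z\<bar> * b powr (exponent \<nu> z - (1 + \<nu>)) * (b - x) powr (\<nu> - real l)"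
proof (cases "snd z = 0")
  case True
  then have e: "exponent \<nu> z = real (fst z)"
    by (simp add: exponent_def)
  with assms(4) have "fst z < Suc l"
    by (simp add: exponents_below_def)
  then have "(\<Prod>i<Suc l. real i - exponent \<nu> z) = 0"
    unfolding e by (intro prod_zero bexI[of _ "fst z"]) auto
  then show ?thesis
    unfolding powr_derivative_def by (simp only: mult_zero_left abs_zero order_refl)
next
  case False
  then have "1 * (\<nu> + 1) \<le> real (snd z) * (\<nu> + 1)"
    using assms(1) by (intro mult_right_mono) auto
  then have e: "0 \<le> exponent \<nu> z - (1 + \<nu>)"
    by (simp add: exponent_def)
  have "(b - x) powr (exponent \<nu> z - real (Suc l)) =
      (b - x) powr (exponent \<nu> z - (1 + \<nu>)) * (b - x) powr (\<nu> - real l)"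
    by (simp add: algebra_simps flip: powr_add)
  also have "\<dots> \<le> b powr (exponent \<nu> z - (1 + \<nu>)) * (b - x) powr (\<nu> - real l)"
    using e assms by (intro mult_right_mono powr_mono2) auto
  finally show ?thesis
    by (simp add: powr_derivative_def abs_mult mult.assoc mult_left_mono del: prod.lessThan_Suc)
qed

text \<open>
  The constant comes from the coefficients and the remainder: the derivatives of order \<open>l + 1\<close>
  of the monomials are bounded by multiples of \<open>(b - x) powr (\<nu> - l)\<close>, and so is a bounded function,
  because \<open>\<nu> - l\<close> is negative. Quantifying over \<open>\<phi>\<close> after \<open>C\<close> lets functions that agree on $[0,b]$
  share the constant.
\<close>

lemma expansion_regularity:
  assumes \<nu>: "0 < \<nu>" "\<nu> < 1" and b: "0 < b" and l: "1 \<le> l" and Z: "Ck_on (Suc l) {0..b} Z"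
  obtains C where "\<And>\<phi> \<psi>. \<lbrakk>\<And>x. x \<in> {0..b} \<Longrightarrow>
        \<phi> x = (\<Sum>z\<in>exponents_below \<nu> (Suc l). \<alpha> z * rpow (b - x) (exponent \<nu> z)) + Z x;
      \<And>x. x \<in> {0..b} \<Longrightarrow> (\<phi> has_real_derivative \<psi> x) (at x within {0..b})\<rbrakk> \<Longrightarrow>
      Ck_on 1 {0..b} \<phi> \<and> Ck_on (Suc l) {0..<b} \<phi> \<and>
      (\<forall>x\<in>{0..<b}. \<bar>nth_deriv_within (Suc l) {0..<b} \<phi> x\<bar> \<le> C * (b - x) powr (\<nu> - real l)) \<and>
      Ck_on 0 {0..b} \<psi> \<and> Ck_on l {0..<b} \<psi> \<and>
      (\<forall>x\<in>{0..<b}. \<bar>nth_deriv_within l {0..<b} \<psi> x\<bar> \<le> C * (b - x) powr (\<nu> - real l))"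
proof -
  let ?S = "{0..<b}" and ?I = "exponents_below \<nu> (Suc l)"
  obtain H where H: "H 0 = Z" "continuous_on {0..b} (H (Suc l))"
    "\<And>j x. j < Suc l \<Longrightarrow> x \<in> {0..b} \<Longrightarrow> (H j has_real_derivative H (Suc j) x) (at x within {0..b})"
    using Ck_on_obtain_derivatives[OF Z] by blast
  have "bounded (H (Suc l) ` {0..b})"
    using H(2) by (intro compact_imp_bounded compact_continuous_image) auto
  then obtain M where M: "\<And>x. x \<in> {0..b} \<Longrightarrow> \<bar>H (Suc l) x\<bar> \<le> M"
    unfolding bounded_iff by (metis image_eqI real_norm_def)
  have M0: "0 \<le> M"
    using M[of 0] b by simp
  define G where "G j x = (\<Sum>z\<in>?I. \<alpha> z * powr_derivative b (exponent \<nu> z) j x) + H j x" for j x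
  have G: "(G j has_real_derivative G (Suc j) x) (at x within ?S)" if "j < Suc l" "x \<in> ?S" for j x
    unfolding G_def
    by (intro DERIV_add DERIV_sum DERIV_cmult has_real_derivative_powr_derivative
        has_field_derivative_subset[OF H(3)]) (use that in auto)
  have Gcont: "continuous_on ?S (G (Suc l))"
    unfolding G_def powr_derivative_def
    by (intro continuous_intros continuous_on_subset[OF H(2)]) auto
  define c where "c z = \<bar>\<alpha> z\<bar> * (\<bar>\<Prod>i<Suc l. real i - exponent \<nu> z\<bar> * b powr (exponent \<nu> z - (1 + \<nu>)))" for z
  define C where "C = (\<Sum>z\<in>?I. c z) + M * b powr (real l - \<nu>)"
  have bound: "\<bar>G (Suc l) x\<bar> \<le> C * (b - x) powr (\<nu> - real l)" if x: "x \<in> ?S" for x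
  proof -
    have "\<bar>\<alpha> z * powr_derivative b (exponent \<nu> z) (Suc l) x\<bar> \<le> c z * (b - x) powr (\<nu> - real l)"
      if "z \<in> ?I" for z
      unfolding c_def abs_mult mult.assoc[of "\<bar>\<alpha> z\<bar>"]
      by (intro mult_left_mono powr_derivative_bound) (use that x \<nu> in auto)
    then have "\<bar>\<Sum>z\<in>?I. \<alpha> z * powr_derivative b (exponent \<nu> z) (Suc l) x\<bar>
        \<le> (\<Sum>z\<in>?I. c z * (b - x) powr (\<nu> - real l))"
      by (intro order_trans[OF sum_abs] sum_mono)
    moreover have "\<bar>H (Suc l) x\<bar> \<le> M * b powr (real l - \<nu>) * (b - x) powr (\<nu> - real l)"
    proof -
      have "1 = b powr (real l - \<nu>) * b powr (\<nu> - real l)"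
        using b by (simp flip: powr_add)
      also have "\<dots> \<le> b powr (real l - \<nu>) * (b - x) powr (\<nu> - real l)"
        using x \<nu> l by (intro mult_left_mono powr_mono2') auto
      finally have "M * 1 \<le> M * (b powr (real l - \<nu>) * (b - x) powr (\<nu> - real l))"
        using M0 by (intro mult_left_mono)
      with M[of x] x show ?thesis
        by (simp add: mult.assoc)
    qed
    ultimately show ?thesis
      unfolding G_def C_def distrib_right sum_distrib_right by linarith
  qed
  have nontriv: "at x within ?S \<noteq> bot" if "x \<in> ?S" for x
    using that b by (subst trivial_limit_within) (auto intro!: connected_imp_perfect simp: set_eq_iff)
  show thesis
  proof (rule that[of C])
    fix \<phi> \<psi>
    assume \<phi>: "\<And>x. x \<in> {0..b} \<Longrightarrow>
        \<phi> x = (\<Sum>z\<in>?I. \<alpha> z * rpow (b - x) (exponent \<nu> z)) + Z x"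
      and \<psi>: "\<And>x. x \<in> {0..b} \<Longrightarrow> (\<phi> has_real_derivative \<psi> x) (at x within {0..b})"
    have \<phi>G: "\<phi> x = G 0 x" if "x \<in> ?S" for x
      using that by (auto simp: \<phi> G_def powr_derivative_def H(1) rpow_def intro!: sum.cong)
    have \<psi>G: "\<psi> x = G 1 x" if x: "x \<in> ?S" for x
    proof -
      have "(G 0 has_real_derivative \<psi> x) (at x within ?S)"
        by (rule has_field_derivative_transform_within[OF has_field_derivative_subset[OF \<psi>] zero_less_one x])
          (use x \<phi>G in auto)
      moreover have "(G 0 has_real_derivative G 1 x) (at x within ?S)"
        using G[of 0 x] x by simp
      ultimately show ?thesis
        using nontriv[OF x] by (metis has_real_derivative_iff_has_vector_derivative vector_derivative_within)
    qed
    have 1: "Ck_on 1 {0..b} \<phi>"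
    proof (rule Ck_on_cong)
      have "Ck_on 1 {0..b} (\<lambda>t. rpow t (exponent \<nu> z))" for z
      proof (cases "z = (0, 0)")
        case False
        then have "1 \<le> real (snd z) + real (fst z)"
          by (cases z) auto
        moreover have "0 \<le> real (snd z) * \<nu>"
          using \<nu> by simp
        ultimately have "1 \<le> exponent \<nu> z"
          unfolding exponent_def distrib_left by linarith
        then show ?thesis
          by (intro Ck_on_rpow) simp
      qed (simp add: exponent_def rpow_def del: Ck_on.simps One_nat_def)
      then show "Ck_on 1 {0..b} (\<lambda>x. (\<Sum>z\<in>?I. \<alpha> z * rpow (b - x) (exponent \<nu> z)) + Z x)"
        by (intro Ck_on_add Ck_on_sum Ck_on_cmult Ck_on_reflect Ck_on_mono[OF Z]) auto
    qed (simp add: \<phi>)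
    have 2: "Ck_on (Suc l) ?S \<phi>"
      by (rule Ck_on_cong[OF Ck_on_of_derivatives[of "Suc l" _ G, OF G Gcont]]) (auto simp: \<phi>G)
    have 3: "nth_deriv_within (Suc l) ?S \<phi> x = G (Suc l) x" if "x \<in> ?S" for x
      by (rule nth_deriv_within_eq[OF G nontriv \<phi>G that])
    have 4: "Ck_on 0 {0..b} \<psi>"
    proof -
      obtain g where g: "\<And>x. x \<in> {0..b} \<Longrightarrow> (\<phi> has_real_derivative g x) (at x within {0..b})"
        "Ck_on 0 {0..b} g"
        using 1 unfolding One_nat_def by (rule Ck_on_real_SucE) blast
      have "g x = \<psi> x" if "x \<in> {0..b}" for x
        using g(1)[OF that] \<psi>[OF that] that b
        by (metis has_real_derivative_iff_has_vector_derivative vector_derivative_within_closed_interval)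
      with g(2) show ?thesis by (rule Ck_on_cong)
    qed
    have 5: "Ck_on l ?S \<psi>"
    proof (rule Ck_on_cong)
      show "Ck_on l ?S (G (Suc 0))"
        by (rule Ck_on_of_derivatives[where G = "\<lambda>j. G (Suc j)"]) (use G Gcont in auto)
    qed (simp add: \<psi>G)
    have 6: "nth_deriv_within l ?S \<psi> x = G (Suc l) x" if "x \<in> ?S" for x
      by (rule nth_deriv_within_eq[where G = "\<lambda>j. G (Suc j)"]) (use G nontriv \<psi>G that in auto)
    show "Ck_on 1 {0..b} \<phi> \<and> Ck_on (Suc l) ?S \<phi> \<and>
      (\<forall>x\<in>?S. \<bar>nth_deriv_within (Suc l) ?S \<phi> x\<bar> \<le> C * (b - x) powr (\<nu> - real l)) \<and>
      Ck_on 0 {0..b} \<psi> \<and> Ck_on l ?S \<psi> \<and>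
      (\<forall>x\<in>?S. \<bar>nth_deriv_within l ?S \<psi> x\<bar> \<le> C * (b - x) powr (\<nu> - real l))"
      using 1 2 4 5 bound by (simp add: 3 6 del: Ck_on.simps)
  qed
qed

section \<open>Uniqueness of the solution\<close>

lemma compact_D_R: "compact (D_R b)"
proof -
  have "D_R b = ({0..b} \<times> {0..b}) \<inter> {z. fst z \<le> snd z}"
    by (auto simp: D_R_def)
  then show ?thesis
    by (auto intro!: compact_Int_closed compact_Times closed_Collect_le continuous_intros)
qed

text \<open>
  Picard's argument. The right-hand side at \<open>s\<close> only involves values of \<open>w\<close> on $[0,s]$, so it is bounded
  by \<open>B\<close> times any increasing bound of \<open>w\<close>. Integrating repeatedly from \<open>w 0 = 0\<close> gives
  \<open>\<bar>w t\<bar> \<le> S * (B * t) ^ n / fact n\<close> for every \<open>n\<close>, which tends to zero.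
\<close>

lemma homogeneous_equation_unique:
  fixes K :: "real \<times> real \<Rightarrow> real"
  assumes \<nu>: "0 < \<nu>" and A: "continuous_on {0..b} A" and K: "continuous_on (D_R b) K"
    and w: "\<And>t. t \<in> {0..b} \<Longrightarrow> (w has_real_derivative
      A t * w t + c * (t powr \<nu> * integral {0..1}
        (\<lambda>\<tau>. K (b - t, b - t * abel_node \<nu> \<tau>) * w (t * abel_node \<nu> \<tau>)))) (at t within {0..b})"
    and w0: "w 0 = 0" and t: "t \<in> {0..b}"
  shows "w t = 0"
proof -
  note node = abel_node_props[OF \<nu>]
  have w_cont: "continuous_on {0..b} w"
    by (rule DERIV_continuous_on[OF w])
  have "bounded (w ` {0..b})" "bounded (A ` {0..b})" "bounded (K ` D_R b)"
    using w_cont A K compact_D_R by (auto intro!: compact_imp_bounded compact_continuous_image)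
  then obtain S MA MK where S: "\<And>t. t \<in> {0..b} \<Longrightarrow> \<bar>w t\<bar> \<le> S"
    and MA: "\<And>t. t \<in> {0..b} \<Longrightarrow> \<bar>A t\<bar> \<le> MA" and MK: "\<And>z. z \<in> D_R b \<Longrightarrow> \<bar>K z\<bar> \<le> MK"
    unfolding bounded_iff by (metis image_eqI real_norm_def)
  have MA0: "0 \<le> MA" and MK0: "0 \<le> MK" and S0: "0 \<le> S"
    using MA[OF t] S[OF t] MK[of "(b, b)"] t by (auto simp: D_R_def)
  define B where "B = MA + \<bar>c\<bar> * b powr \<nu> * MK"
  have B_mult: "MA * e + \<bar>c\<bar> * (b powr \<nu> * (MK * e)) = B * e" for e
    by (simp add: B_def algebra_simps)
  define w' where "w' t = A t * w t + c * (t powr \<nu> * integral {0..1}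
        (\<lambda>\<tau>. K (b - t, b - t * abel_node \<nu> \<tau>) * w (t * abel_node \<nu> \<tau>)))" for t
  have bound: "\<forall>t\<in>{0..b}. \<bar>w t\<bar> \<le> S * (B * t) ^ n / fact n" for n
  proof (induction n)
    case 0
    then show ?case using S by simp
  next
    case (Suc n)
    have B0: "0 \<le> B"
      using MA0 MK0 by (simp add: B_def)
    have w': "\<bar>w' s\<bar> \<le> B * (S * (B * s) ^ n / fact n)" if s: "s \<in> {0..b}" for s
    proof -
      let ?e = "S * (B * s) ^ n / fact n"
      have e0: "0 \<le> ?e"
        using S0 B0 s by simp
      have "norm (integral {0..1} (\<lambda>\<tau>. 1 * K (b - s, b - s * abel_node \<nu> \<tau>) * w (s * abel_node \<nu> \<tau>)))
        \<le> MK * ?e * (1 - 0)"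
      proof (rule integral_bound)
        show "continuous_on {0..1} (\<lambda>\<tau>. 1 * K (b - s, b - s * abel_node \<nu> \<tau>) * w (s * abel_node \<nu> \<tau>))"
          by (rule continuous_on_kernel_slice[OF K w_cont node continuous_on_const s])
        fix \<tau> :: real assume "\<tau> \<in> {0..1}"
        then have n: "abel_node \<nu> \<tau> \<in> {0..1}"
          using node(2) by (auto simp: image_subset_iff)
        have "\<bar>w (s * abel_node \<nu> \<tau>)\<bar> \<le> S * (B * (s * abel_node \<nu> \<tau>)) ^ n / fact n"
          using Suc.IH D_R_segment(2)[OF s n] by blast
        also have "\<dots> \<le> ?e"
          using S0 B0 s n by (intro divide_right_mono mult_left_mono power_mono) (auto simp: mult_left_le)
        finally show "norm (1 * K (b - s, b - s * abel_node \<nu> \<tau>) * w (s * abel_node \<nu> \<tau>)) \<le> MK * ?e"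
          unfolding real_norm_def abs_mult
          using MK[OF D_R_segment(1)[OF s n]] MK0 by (intro mult_mono) auto
      qed auto
      then have int: "\<bar>integral {0..1} (\<lambda>\<tau>. K (b - s, b - s * abel_node \<nu> \<tau>) * w (s * abel_node \<nu> \<tau>))\<bar> \<le> MK * ?e"
        by simp
      have "\<bar>w' s\<bar> \<le> \<bar>A s\<bar> * \<bar>w s\<bar> + \<bar>c\<bar> * (s powr \<nu> *
          \<bar>integral {0..1} (\<lambda>\<tau>. K (b - s, b - s * abel_node \<nu> \<tau>) * w (s * abel_node \<nu> \<tau>))\<bar>)"
        unfolding w'_def by (rule order_trans[OF abs_triangle_ineq]) (simp add: abs_mult)
      also have "\<dots> \<le> MA * ?e + \<bar>c\<bar> * (b powr \<nu> * (MK * ?e))"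
        using MA[OF s] Suc.IH s int \<nu> MA0
        by (intro add_mono mult_mono mult_left_mono powr_mono2) auto
      also have "\<dots> = B * ?e"
        by (rule B_mult)
      finally show ?thesis .
    qed
    show ?case
    proof
      fix t assume t: "t \<in> {0..b}"
      let ?h = "\<lambda>s. S * (B * s) ^ Suc n / fact (Suc n)"
      have h: "(?h has_real_derivative B * (S * (B * s) ^ n / fact n)) (at s within {0..b})" for s
      proof -
        have "(?h has_real_derivative S * (real (Suc n) * (B * s) ^ n * B) / fact (Suc n)) (at s within {0..b})"
          by (rule derivative_eq_intros refl | simp)+
        also have "S * (real (Suc n) * (B * s) ^ n * B) / fact (Suc n) = B * (S * (B * s) ^ n / fact n)"
          by (simp add: field_simps del: of_nat_Suc)
        finally show ?thesis .
      qed
      \<comment> \<open>With \<open>\<sigma>\<close> equal to \<open>1\<close> and \<open>-1\<close>, the mean value theorem bounds \<open>w\<close> from below and above.\<close>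
      have mono: "?h 0 + \<sigma> * w 0 \<le> ?h t + \<sigma> * w t" if "\<bar>\<sigma>\<bar> = 1" for \<sigma>
      proof (rule DERIV_nonneg_imp_increasing_open[where f = "\<lambda>s. ?h s + \<sigma> * w s"])
        have der: "((\<lambda>s. ?h s + \<sigma> * w s) has_real_derivative B * (S * (B * s) ^ n / fact n) + \<sigma> * w' s)
            (at s within {0..b})" if "s \<in> {0..b}" for s
          unfolding w'_def by (intro DERIV_add DERIV_cmult h w that)
        show "continuous_on {0..t} (\<lambda>s. ?h s + \<sigma> * w s)"
          by (rule continuous_on_subset[OF DERIV_continuous_on[OF der]]) (use t in auto)
        fix s assume s: "0 < s" "s < t"
        then have "s \<in> {0..b}" using t by auto
        moreover have "\<bar>\<sigma> * w' s\<bar> \<le> B * (S * (B * s) ^ n / fact n)"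
          using w'[OF calculation] that by (simp add: abs_mult)
        then have "0 \<le> B * (S * (B * s) ^ n / fact n) + \<sigma> * w' s"
          by linarith
        ultimately show "\<exists>y. ((\<lambda>s. ?h s + \<sigma> * w s) has_real_derivative y) (at s) \<and> 0 \<le> y"
          using der[of s] s t by (auto simp: at_within_Icc_at)
      qed (use t in auto)
      from mono[of 1] mono[of "-1"] w0 show "\<bar>w t\<bar> \<le> ?h t"
        by simp
    qed
  qed
  have "(\<lambda>n. S * (inverse (fact n) * (B * t) ^ n)) \<longlonglongrightarrow> S * 0"
    by (intro tendsto_mult_left summable_LIMSEQ_zero summable_exp)
  then have "(\<lambda>n. S * (B * t) ^ n / fact n) \<longlonglongrightarrow> 0"
    by (simp add: field_simps)
  then have "\<bar>w t\<bar> \<le> 0"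
    by (rule LIMSEQ_le_const) (use bound t in auto)
  then show ?thesis by simp
qed

section \<open>The terminal value problem\<close>

text \<open>
  In the distance \<open>t = b - x\<close> from the terminal point the problem becomes an initial value problem of
  the form treated above.
\<close>

lemma terminal_solution_reflected:
  assumes \<nu>: "0 < \<nu>" and K: "continuous_on (D_R b) K"
    and \<phi>: "terminal_solution b \<nu> a chi K \<phi>\<^sub>b \<phi>" and t: "t \<in> {0..b}"
  shows "((\<lambda>t. \<phi> (b - t)) has_real_derivative
    - a (b - t) * \<phi> (b - t) + - chi (b - t) + - (1 / \<nu>) * (t powr \<nu> * integral {0..1}
      (\<lambda>\<tau>. K (b - t, b - t * abel_node \<nu> \<tau>) * \<phi> (b - t * abel_node \<nu> \<tau>)))) (at t within {0..b})"
proof -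
  have deriv: "(\<phi> has_real_derivative (a x * \<phi> x + chi x +
      integral {x..b} (\<lambda>s. (s - x) powr (\<nu> - 1) * K (x, s) * \<phi> s))) (at x within {0..b})"
    if "x \<in> {0..b}" for x
    using \<phi> that unfolding terminal_solution_def by blast
  have cont: "continuous_on {0..b} \<phi>"
    by (rule DERIV_continuous_on[OF deriv])
  have "continuous_on {b - t..b} (\<lambda>s. K (b - t, s) * \<phi> s)"
    by (intro continuous_on_mult continuous_on_compose2[OF K] continuous_on_subset[OF cont]
        continuous_intros) (use t in \<open>auto simp: D_R_def\<close>)
  from abel_integral_substitution[OF \<nu> _ this] t
  have I: "integral {b - t..b} (\<lambda>s. (s - (b - t)) powr (\<nu> - 1) * K (b - t, s) * \<phi> s) =
      t powr \<nu> / \<nu> * integral {0..1} (\<lambda>\<tau>. K (b - t, b - t * abel_node \<nu> \<tau>) * \<phi> (b - t * abel_node \<nu> \<tau>))"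
    by (simp add: mult.assoc)
  have im: "(\<lambda>t. b - t) ` {0..b} = {0..b}"
    by auto
  have "((\<lambda>t. b - t) has_real_derivative -1) (at t within {0..b})"
    by (auto intro!: derivative_eq_intros)
  from DERIV_image_chain[OF _ this, unfolded im, OF deriv] t show ?thesis
    unfolding I by (simp add: o_def algebra_simps)
qed

lemma terminal_solution_unique:
  assumes \<nu>: "0 < \<nu>" and a: "continuous_on {0..b} a" and K: "continuous_on (D_R b) K"
    and \<phi>: "terminal_solution b \<nu> a chi K \<phi>\<^sub>b \<phi>1" "terminal_solution b \<nu> a chi K \<phi>\<^sub>b \<phi>2"
    and x: "x \<in> {0..b}"
  shows "\<phi>1 x = \<phi>2 x"
proof -
  define w where "w t = \<phi>1 (b - t) - \<phi>2 (b - t)" for t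
  have cont: "continuous_on {0..b} (\<lambda>t. \<phi> (b - t))" if "terminal_solution b \<nu> a chi K \<phi>\<^sub>b \<phi>" for \<phi>
    by (rule DERIV_continuous_on[OF terminal_solution_reflected[OF \<nu> K that]])
  have "w (b - x) = 0"
  proof (rule homogeneous_equation_unique[OF \<nu> _ K, where A = "\<lambda>t. - a (b - t)" and c = "- (1 / \<nu>)" and w = w])
    show "continuous_on {0..b} (\<lambda>t. - a (b - t))"
      using Ck_on_reflect[of 0 b a] a by (auto intro: continuous_intros)
    fix t assume t: "t \<in> {0..b}"
    have int: "(\<lambda>\<tau>. K (b - t, b - t * abel_node \<nu> \<tau>) * \<phi> (b - t * abel_node \<nu> \<tau>)) integrable_on {0..1}"
      if "terminal_solution b \<nu> a chi K \<phi>\<^sub>b \<phi>" for \<phi>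
      using integrable_kernel_product[OF K cont[OF that] abel_node_props[OF \<nu>], of "\<lambda>_. 1" t] t by simp
    have I: "integral {0..1} (\<lambda>\<tau>. K (b - t, b - t * abel_node \<nu> \<tau>) * w (t * abel_node \<nu> \<tau>)) =
      integral {0..1} (\<lambda>\<tau>. K (b - t, b - t * abel_node \<nu> \<tau>) * \<phi>1 (b - t * abel_node \<nu> \<tau>))
      - integral {0..1} (\<lambda>\<tau>. K (b - t, b - t * abel_node \<nu> \<tau>) * \<phi>2 (b - t * abel_node \<nu> \<tau>))"
      unfolding w_def right_diff_distrib by (intro Henstock_Kurzweil_Integration.integral_diff int \<phi>)
    note diff = DERIV_diff[OF terminal_solution_reflected[OF \<nu> K \<phi>(1) t]
        terminal_solution_reflected[OF \<nu> K \<phi>(2) t], folded w_def]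
    show "(w has_real_derivative - a (b - t) * w t + - (1 / \<nu>) * (t powr \<nu> *
        integral {0..1} (\<lambda>\<tau>. K (b - t, b - t * abel_node \<nu> \<tau>) * w (t * abel_node \<nu> \<tau>)))) (at t within {0..b})"
      unfolding I by (rule DERIV_cong[OF diff]) (simp add: w_def algebra_simps)
  qed (use x \<phi> in \<open>auto simp: w_def terminal_solution_def\<close>)
  then show ?thesis
    by (simp add: w_def)
qed

text \<open>
  Continuity of \<open>\<phi>\<close> is an expansion without monomials and with a remainder of class $C^0$; each of the \<open>l + 1\<close> bootstrap steps uses one more order of smoothness of the data, the last
  one using all \<open>l\<close> orders.
\<close>

lemma terminal_solution_has_expansion:
  assumes \<nu>: "0 < \<nu>" and a: "Ck_on l {0..b} a" and chi: "Ck_on l {0..b} chi" and K: "Ck_on l (D_R b) K"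
    and \<phi>: "terminal_solution b \<nu> a chi K \<phi>\<^sub>b \<phi>"
  shows "has_expansion \<nu> b (Suc l) (\<lambda>t. \<phi> (b - t))"
proof -
  have Kc: "continuous_on (D_R b) K"
    using K Ck_on_imp_continuous_on by blast
  note deriv = terminal_solution_reflected[OF \<nu> Kc \<phi>]
  have neg: "Ck_on l {0..b} (\<lambda>t. - f (b - t))" if "Ck_on l {0..b} f" for f
    using Ck_on_cmult[OF Ck_on_reflect[OF that], of "-1"] by simp
  have "m \<le> Suc l \<Longrightarrow> has_expansion \<nu> b m (\<lambda>t. \<phi> (b - t))" for m
  proof (induction m)
    case 0
    show ?case
      using DERIV_continuous_on[OF deriv] by (intro has_expansion_Ck_on) simp
  next
    case (Suc m)
    then have "m \<le> l" by simp
    note mono = Ck_on_mono[OF _ this]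
    show ?case
      by (rule has_expansion_bootstrap[OF \<nu> mono[OF neg[OF a]] mono[OF neg[OF chi]] mono[OF K] deriv])
        (use Suc in auto)
  qed
  then show ?thesis by simp
qed

text \<open>
  Both \<open>C\<close> and \<open>\<alpha>\<close> have to be chosen before the solution is given. By uniqueness they may be taken from
  any one solution, and if there is none, the claim is vacuous.
\<close>

theorem theorem2p1:
  fixes b \<nu> \<phi>\<^sub>b :: real
    and l :: nat
    and a chi :: "real \<Rightarrow> real"
    and K :: "real \<times> real \<Rightarrow> real"
  assumes "b > 0"
    and "0 < \<nu>" and "\<nu> < 1"
    and "l \<ge> 1"
    and "Ck_on l {0..b} a"
    and "Ck_on l {0..b} chi"
    and "Ck_on l (D_R b) K"
    and "\<forall>x\<in>{0..b}. K (x, x) \<noteq> 0"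
  shows "\<exists>(C::real) (\<alpha>::nat \<Rightarrow> nat \<Rightarrow> real). \<forall>\<phi> \<psi>.
     terminal_solution b \<nu> a chi K \<phi>\<^sub>b \<phi> \<longrightarrow>
     (\<forall>x\<in>{0..b}. (\<phi> has_real_derivative \<psi> x) (at x within {0..b})) \<longrightarrow>
       Ck_on 1 {0..b} \<phi> \<and> Ck_on (l + 1) {0..<b} \<phi> \<and>
       (\<forall>x\<in>{0..<b}. \<bar>nth_deriv_within (l + 1) {0..<b} \<phi> x\<bar> \<le> C * (b - x) powr (\<nu> - real l)) \<and>
       (\<exists>Y. Ck_on (l + 1) {0..b} Y \<and>
          (\<forall>x\<in>{0..b}. \<phi> x =
             (\<Sum>(i, k)\<in>index_set_R \<nu> l. \<alpha> i k * rpow (b - x) (real k * (\<nu> + 1) + real i)) + Y x)) \<and>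
       Ck_on 0 {0..b} \<psi> \<and> Ck_on l {0..<b} \<psi> \<and>
       (\<forall>x\<in>{0..<b}. \<bar>nth_deriv_within l {0..<b} \<psi> x\<bar> \<le> C * (b - x) powr (\<nu> - real l))"
proof (cases "\<exists>\<phi>. terminal_solution b \<nu> a chi K \<phi>\<^sub>b \<phi>")
  case False
  then show ?thesis by blast
next
  case True
  then obtain \<phi>0 where \<phi>0: "terminal_solution b \<nu> a chi K \<phi>\<^sub>b \<phi>0" ..
  obtain \<alpha> Y where Y: "Ck_on (Suc l) {0..b} Y"
    and exp: "\<And>t. t \<in> {0..b} \<Longrightarrow>
      \<phi>0 (b - t) = (\<Sum>z\<in>exponents_below \<nu> (Suc l). \<alpha> z * rpow t (exponent \<nu> z)) + Y t"
    using terminal_solution_has_expansion[OF assms(2,5-7) \<phi>0] unfolding has_expansion_def by blast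
  define Z where "Z x = Y (b - x)" for x
  have Z: "Ck_on (Suc l) {0..b} Z"
    unfolding Z_def using Ck_on_reflect[OF Y] .
  have uniq: "\<phi> x = (\<Sum>z\<in>exponents_below \<nu> (Suc l). \<alpha> z * rpow (b - x) (exponent \<nu> z)) + Z x"
    if "terminal_solution b \<nu> a chi K \<phi>\<^sub>b \<phi>" "x \<in> {0..b}" for \<phi> x
  proof -
    have "\<phi> x = \<phi>0 x"
      by (rule terminal_solution_unique[OF assms(2) _ _ that(1) \<phi>0 that(2)])
        (use assms(5,7) Ck_on_imp_continuous_on in blast)+
    with exp[of "b - x"] that(2) show ?thesis
      by (simp add: Z_def)
  qed
  obtain C where C: "\<And>\<phi> \<psi>. \<lbrakk>\<And>x. x \<in> {0..b} \<Longrightarrow>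
        \<phi> x = (\<Sum>z\<in>exponents_below \<nu> (Suc l). \<alpha> z * rpow (b - x) (exponent \<nu> z)) + Z x;
      \<And>x. x \<in> {0..b} \<Longrightarrow> (\<phi> has_real_derivative \<psi> x) (at x within {0..b})\<rbrakk> \<Longrightarrow>
      Ck_on 1 {0..b} \<phi> \<and> Ck_on (Suc l) {0..<b} \<phi> \<and>
      (\<forall>x\<in>{0..<b}. \<bar>nth_deriv_within (Suc l) {0..<b} \<phi> x\<bar> \<le> C * (b - x) powr (\<nu> - real l)) \<and>
      Ck_on 0 {0..b} \<psi> \<and> Ck_on l {0..<b} \<psi> \<and>
      (\<forall>x\<in>{0..<b}. \<bar>nth_deriv_within l {0..<b} \<psi> x\<bar> \<le> C * (b - x) powr (\<nu> - real l))"
    using expansion_regularity[OF assms(2,3,1,4) Z] by blast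
  have sum_eq: "(\<Sum>z\<in>exponents_below \<nu> (Suc l). \<alpha> z * rpow t (exponent \<nu> z)) =
      (\<Sum>(i, k)\<in>index_set_R \<nu> l. \<alpha> (i, k) * rpow t (real k * (\<nu> + 1) + real i))" for t
    by (intro sum.cong)
      (auto simp: exponents_below_def index_set_R_def exponent_def add.commute)
  show ?thesis
  proof (intro exI[of _ C] exI[of _ "\<lambda>i k. \<alpha> (i, k)"] allI impI)
    fix \<phi> \<psi>
    assume sol: "terminal_solution b \<nu> a chi K \<phi>\<^sub>b \<phi>"
      and "\<forall>x\<in>{0..b}. (\<phi> has_real_derivative \<psi> x) (at x within {0..b})"
    then have reg: "Ck_on 1 {0..b} \<phi> \<and> Ck_on (Suc l) {0..<b} \<phi> \<and>
      (\<forall>x\<in>{0..<b}. \<bar>nth_deriv_within (Suc l) {0..<b} \<phi> x\<bar> \<le> C * (b - x) powr (\<nu> - real l)) \<and>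
      Ck_on 0 {0..b} \<psi> \<and> Ck_on l {0..<b} \<psi> \<and>
      (\<forall>x\<in>{0..<b}. \<bar>nth_deriv_within l {0..<b} \<psi> x\<bar> \<le> C * (b - x) powr (\<nu> - real l))"
      by (intro C uniq[OF sol]) auto
    have "\<exists>Y. Ck_on (Suc l) {0..b} Y \<and>
          (\<forall>x\<in>{0..b}. \<phi> x =
             (\<Sum>(i, k)\<in>index_set_R \<nu> l. \<alpha> (i, k) * rpow (b - x) (real k * (\<nu> + 1) + real i)) + Y x)"
      using Z uniq[OF sol] unfolding sum_eq by blast
    with reg show "Ck_on 1 {0..b} \<phi> \<and> Ck_on (l + 1) {0..<b} \<phi> \<and>
       (\<forall>x\<in>{0..<b}. \<bar>nth_deriv_within (l + 1) {0..<b} \<phi> x\<bar> \<le> C * (b - x) powr (\<nu> - real l)) \<and>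
       (\<exists>Y. Ck_on (l + 1) {0..b} Y \<and>
          (\<forall>x\<in>{0..b}. \<phi> x =
             (\<Sum>(i, k)\<in>index_set_R \<nu> l. \<alpha> (i, k) * rpow (b - x) (real k * (\<nu> + 1) + real i)) + Y x)) \<and>
       Ck_on 0 {0..b} \<psi> \<and> Ck_on l {0..<b} \<psi> \<and>
       (\<forall>x\<in>{0..<b}. \<bar>nth_deriv_within l {0..<b} \<psi> x\<bar> \<le> C * (b - x) powr (\<nu> - real l))"
      unfolding Suc_eq_plus1[symmetric] by blast
  qed
qed

end
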